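(* Let $X$ be a closed set in $\mathbb{R}^n$, and let $S=S_0\circ F$ for an outer semicontinuous mapping $S_0:\mathbb{R}^p\rightrightarrows\mathbb{R}^m$ and a single-valued mapping $F:\mathbb{R}^n\to\mathbb{R}^p$. Let $\bar{u}\in S|_X(\bar{x})$. If $$D^*S_0(F(\bar{x})\mid\bar{u})(0)\cap D^*_XF(\bar{x})^{-1}(0)=\{0\},$$ then $$D^*_XS(\bar{x}\mid\bar{u})\subseteq D^*_XF(\bar{x})\circ D^*S_0(F(\bar{x})\mid\bar{u}).$$ Still under the same condition $D^*S_0(F(\bar{x})\mid\bar{u})(0)\cap D^*_XF(\bar{x})^{-1}(0)=\{0\}$, suppose that $F$ is strictly continuous at $\bar{x}$ relative to $X$, $S_0$ is graphically regular at $F(\bar{x})$ for $\bar{u}$, the function $zF|_X$ is regular at $\bar{x}$ for all $z\in\operatorname{rg}D^*S_0(F(\bar{x})\mid\bar{u})$, and $X$ is a smooth manifold around $\bar{x}$. Then $S|_X$ is graphically regular at $\bar{x}$ for $\bar{u}$, and $$D^*_XS(\bar{x}\mid\bar{u})=D^*_XF(\bar{x})\circ D^*S_0(F(\bar{x})\mid\bar{u}).$$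
   Context: For $C\subseteq\mathbb{R}^n$ and $x\in C$: $T_C(x)=\limsup_{t\searrow 0}\frac{C-x}{t}$ (outer limit) is the tangent (contingent) cone; the regular normal cone is $\widehat{N}_C(x)=\{v\mid \limsup_{x'\to x,\,x'\in C,\,x'\neq x}\langle v,x'-x\rangle/\|x'-x\|\le 0\}$; the limiting normal cone $N_C(x)$ is the set of $v$ for which there are $x_k\to x$, $x_k\in C$, and $v_k\to v$ with $v_k\in\widehat{N}_C(x_k)$. These are empty for $x\notin C$. $C$ is (Clarke) regular at $x\in C$ if it is locally closed at $x$ (i.e. $C\cap U$ is closed for some closed neighborhood $U$ of $x$) and $\widehat{N}_C(x)=N_C(x)$. $\operatorname{proj}_C(x)=\{y\in C\mid\|y-x\|=d(x,C)\}$, where $d(x,C)$ is the distance from $x$ to $C$, and $\operatorname{proj}_CA=\bigcup_{a\in A}\operatorname{proj}_C(a)$. For a set-valued mapping $S$, $\operatorname{gph}S=\{(x,u)\mid u\in S(x)\}$; $\operatorname{rg}S$ is its range; $S|_X$ equals $S(x)$ for $x\in X$ and $\emptyset$ for $x\notin X$; $S^{-1}(u)=\{x\mid u\in S(x)\}$; $(A\circ B)(y)=\bigcup_{z\in B(y)}A(z)$; inclusions of mappings are argumentwise. The coderivative is defined by $x^*\in D^*S(\bar{x}\mid\bar{u})(u^* )\iff(x^*,-u^* )\in N_{\operatorname{gph}S}(\bar{x},\bar{u})$. The projectional coderivative (for $\bar{x}\in X$, $\bar{u}\in S(\bar{x})$, $S:\mathbb{R}^n\rightrightarrows\mathbb{R}^m$)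 is defined by $$t^*\in D^*_XS(\bar{x}\mid\bar{u})(u^* )\iff(t^*,-u^* )\in\limsup_{(x,u)\to(\bar{x},\bar{u}),\,(x,u)\in\operatorname{gph}S|_X}\operatorname{proj}_{T_X(x)\times\mathbb{R}^m}N_{\operatorname{gph}S|_X}(x,u),$$ with $\limsup$ the (Painlevé–Kuratowski) outer limit of sets; for single-valued $F$, $D^*_XF(\bar{x})=D^*_XF(\bar{x}\mid F(\bar{x}))$. A mapping $S_0:\mathbb{R}^p\rightrightarrows\mathbb{R}^m$ is outer semicontinuous if $\limsup_{w\to w_0}S_0(w)=S_0(w_0)$ for every $w_0\in\mathbb{R}^p$. $F$ is strictly continuous at $\bar{x}\in X$ relative to $X$ if $F$ is Lipschitz continuous on $X\cap V$ for some neighborhood $V$ of $\bar{x}$. A mapping $S$ is graphically regular at $\bar{x}$ for $\bar{u}$ if $\operatorname{gph}S$ is regular at $(\bar{x},\bar{u})$. The function $zF|_X:\mathbb{R}^n\to\overline{\mathbb{R}}$ is $(zF|_X)(x)=\langle z,F(x)\rangle$ for $x\in X$ and $+\infty$ for $x\notin X$; an extended real-valued function $f$ is regular at $\bar{x}$ if its epigraph is regular at the point $(\bar{x},f(\bar{x}))$. $X$ is a ($d$-dimensional) smooth manifold around $\bar{x}\in X$ if there are an open neighborhood $O$ of $\bar{x}$ and a $\mathcal{C}^1$ mapping $G:O\to\mathbb{R}^{n-d}$ with $\nabla G(\bar{x})$ of full rank $n-d$ such that $X\cap O=\{x\in O\mid G(x)=0\}$.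
   Formalization: For the first inclusion, F is additionally assumed continuous on X near x̄; for merely single-valued F it fails, e.g. X=ℝ, x̄=ū=0, F(x)=0 for x≤0, F(x)=1+x for x>0, S₀(w)={max(0,w−1)}. The second part is unchanged. *)

theory Defs
  imports "HOL-Analysis.Analysis"
begin

section \<open>Set-valued mappings\<close>

type_synonym ('a, 'b) setmap = "'a \<Rightarrow> 'b set"

definition single_valued_map :: "('a \<Rightarrow> 'b) \<Rightarrow> ('a, 'b) setmap"
  where "single_valued_map F = (\<lambda>x. {F x})"

definition gph :: "('a, 'b) setmap \<Rightarrow> ('a \<times> 'b) set"
  where "gph S = {(x, u). u \<in> S x}"

definition rg :: "('a, 'b) setmap \<Rightarrow> 'b set"
  where "rg S = (\<Union>x. S x)"

definition restr :: "('a, 'b) setmap \<Rightarrow> 'a set \<Rightarrow> ('a, 'b) setmap"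
  where "restr S X = (\<lambda>x. if x \<in> X then S x else {})"

definition inv_map :: "('a, 'b) setmap \<Rightarrow> ('b, 'a) setmap"
  where "inv_map S = (\<lambda>u. {x. u \<in> S x})"

definition comp_map :: "('b, 'c) setmap \<Rightarrow> ('a, 'b) setmap \<Rightarrow> ('a, 'c) setmap"
  where "comp_map A B = (\<lambda>y. \<Union>z\<in>B y. A z)"

text \<open>
  Painleve--Kuratowski outer limit, in its sequential form, along a filter on the argument. As in
  the usual convention for set limits, a limit as \<open>x\<close> tends to \<open>x0\<close> (filter \<^term>\<open>nhds x0\<close>) does not
  exclude \<open>x = x0\<close>. All filters used below are countably generated, so that sequences suffice.
\<close>
definition outer_limit :: "'a filter \<Rightarrow> ('a, 'b::topological_space) setmap \<Rightarrow> 'b set"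
  where "outer_limit \<F> S =
    {u. \<exists>xs us. filterlim xs \<F> sequentially \<and> (\<forall>k::nat. us k \<in> S (xs k)) \<and> us \<longlonglongrightarrow> u}"

definition outer_semicontinuous ::
    "('a::topological_space, 'b::topological_space) setmap \<Rightarrow> bool"
  where "outer_semicontinuous S \<longleftrightarrow> (\<forall>w. outer_limit (nhds w) S = S w)"


section \<open>Tangent and normal cones, regularity of sets and functions\<close>

definition tangent_cone :: "'a::euclidean_space set \<Rightarrow> 'a \<Rightarrow> 'a set"
  where "tangent_cone C x =
    {w. x \<in> C \<and> w \<in> outer_limit (at_right (0::real)) (\<lambda>t. (\<lambda>y. (y - x) /\<^sub>R t) ` C)}"

text \<open>
  If \<open>x\<close> is an isolated point of \<open>C\<close>, the filter \<^term>\<open>at x within C\<close> is trivial and the upper limit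
  is minus infinity, so that the regular normal cone is the whole space.
\<close>
definition regular_normal_cone :: "'a::euclidean_space set \<Rightarrow> 'a \<Rightarrow> 'a set"
  where "regular_normal_cone C x =
    {v. x \<in> C \<and> Limsup (at x within C) (\<lambda>y. ereal ((v \<bullet> (y - x)) / norm (y - x))) \<le> 0}"

definition normal_cone :: "'a::euclidean_space set \<Rightarrow> 'a \<Rightarrow> 'a set"
  where "normal_cone C x =
    {v. x \<in> C \<and> (\<exists>xs vs. (\<forall>k::nat. xs k \<in> C \<and> vs k \<in> regular_normal_cone C (xs k)) \<and>
          xs \<longlonglongrightarrow> x \<and> vs \<longlonglongrightarrow> v)}"

definition locally_closed_at :: "'a::topological_space set \<Rightarrow> 'a \<Rightarrow> bool"
  where "locally_closed_at C x \<longleftrightarrow> (\<exists>U. closed U \<and> x \<in> interior U \<and> closed (C \<inter> U))"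

definition clarke_regular :: "'a::euclidean_space set \<Rightarrow> 'a \<Rightarrow> bool"
  where "clarke_regular C x \<longleftrightarrow>
    x \<in> C \<and> locally_closed_at C x \<and> regular_normal_cone C x = normal_cone C x"

definition graphically_regular ::
    "('a::euclidean_space, 'b::euclidean_space) setmap \<Rightarrow> 'a \<Rightarrow> 'b \<Rightarrow> bool"
  where "graphically_regular S x u \<longleftrightarrow> clarke_regular (gph S) (x, u)"

definition epi :: "('a \<Rightarrow> ereal) \<Rightarrow> ('a \<times> real) set"
  where "epi f = {(x, \<alpha>). f x \<le> ereal \<alpha>}"

definition regular_function :: "('a::euclidean_space \<Rightarrow> ereal) \<Rightarrow> 'a \<Rightarrow> bool"
  where "regular_function f x \<longleftrightarrow>
    \<bar>f x\<bar> \<noteq> \<infinity> \<and> clarke_regular (epi f) (x, real_of_ereal (f x))"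

definition scalarization ::
    "'b::real_inner \<Rightarrow> ('a \<Rightarrow> 'b) \<Rightarrow> 'a set \<Rightarrow> 'a \<Rightarrow> ereal"
  where "scalarization z F X = (\<lambda>x. if x \<in> X then ereal (z \<bullet> F x) else \<infinity>)"


section \<open>Projections and coderivatives\<close>

definition proj_set :: "'a::euclidean_space set \<Rightarrow> 'a \<Rightarrow> 'a set"
  where "proj_set C x = {y \<in> C. norm (y - x) = infdist x C}"

definition coderivative ::
    "('a::euclidean_space, 'b::euclidean_space) setmap \<Rightarrow> 'a \<Rightarrow> 'b \<Rightarrow> ('b, 'a) setmap"
  where "coderivative S x u = (\<lambda>u'. {x'. (x', - u') \<in> normal_cone (gph S) (x, u)})"

definition proj_coderivative ::
    "'a::euclidean_space set \<Rightarrow> ('a, 'b::euclidean_space) setmap \<Rightarrow> 'a \<Rightarrow> 'b \<Rightarrow> ('b, 'a) setmap"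
  where "proj_coderivative X S x u = (\<lambda>u'. {t'. (t', - u') \<in>
    outer_limit (inf (nhds (x, u)) (principal (gph (restr S X))))
      (\<lambda>(y, w). \<Union>a \<in> normal_cone (gph (restr S X)) (y, w).
                   proj_set (tangent_cone X y \<times> UNIV) a)})"


section \<open>Relative continuity and smooth manifolds\<close>

definition strictly_continuous_rel ::
    "'a::metric_space set \<Rightarrow> ('a \<Rightarrow> 'b::metric_space) \<Rightarrow> 'a \<Rightarrow> bool"
  where "strictly_continuous_rel X F x \<longleftrightarrow>
    x \<in> X \<and> (\<exists>V L. open V \<and> x \<in> V \<and> L-lipschitz_on (X \<inter> V) F)"

text \<open>
  The chain rule fails if \<open>F\<close> is merely single-valued: for \<open>F x = 0\<close> on \<open>x \<le> 0\<close>, \<open>F x = 1 + x\<close> on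
  \<open>x > 0\<close> and \<open>S0 w = {max 0 (w - 1)}\<close> on the real line, the qualification condition holds at
  \<open>0\<close>, but the inclusion of coderivatives does not, because values of \<open>F\<close> far from \<open>F 0\<close>
  then contribute to the graph of the composition. Continuity at \<open>x\<close> alone is not sufficient either, as
  the graph of \<open>F\<close> over \<open>X\<close> has to be locally closed.
\<close>
definition continuous_rel_around ::
    "'a::topological_space set \<Rightarrow> ('a \<Rightarrow> 'b::topological_space) \<Rightarrow> 'a \<Rightarrow> bool"
  where "continuous_rel_around X F x \<longleftrightarrow> (\<exists>V. open V \<and> x \<in> V \<and> continuous_on (X \<inter> V) F)"

text \<open>
  The map \<open>G\<close> into \<open>\<real>\<^sup>n\<^sup>-\<^sup>d\<close> is given by its component functions \<open>G 0, \<dots>, G (n - d - 1)\<close>, and the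
  rows of its Jacobian are their gradients \<open>DG i\<close>; full rank is full row rank. This covers \<open>d = n\<close>,
  where there are no components.
\<close>
definition smooth_manifold_around :: "nat \<Rightarrow> 'a::euclidean_space set \<Rightarrow> 'a \<Rightarrow> bool"
  where "smooth_manifold_around d X x \<longleftrightarrow>
    d \<le> DIM('a) \<and> x \<in> X \<and>
    (\<exists>U (G :: nat \<Rightarrow> 'a \<Rightarrow> real) (DG :: nat \<Rightarrow> 'a \<Rightarrow> 'a).
       open U \<and> x \<in> U \<and>
       (\<forall>i < DIM('a) - d. (\<forall>y\<in>U. GDERIV (G i) y :> DG i y) \<and> continuous_on U (DG i)) \<and>
       dim (span ((\<lambda>i. DG i x) ` {..<DIM('a) - d})) = DIM('a) - d \<and>
       X \<inter> U = {y \<in> U. \<forall>i < DIM('a) - d. G i y = 0})"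

end

theory Submission
  imports Defs
begin

text \<open>
  The inclusion rests on a chain rule for limiting normals (\<open>normal_cone_chain_rule\<close>): a normal
  \<open>(v, - u')\<close> of the graph of the composition splits into a normal \<open>(z, - u')\<close> of the graph of \<open>S\<^sub>0\<close>
  and a normal \<open>(v, - z)\<close> of the graph of \<open>F\<close> on \<open>X\<close>. It is derived by a penalty
  method: for a proximal normal, the constraint \<open>w = F y\<close> is replaced by the penalty
  \<open>k * norm (F y - w)\<^sup>2\<close>, minimisers exist by compactness, and the first-order conditions at a minimiser
  split into the two normals, with the gradient of the penalty as the multiplier \<open>z\<close>. Multipliers of
  approximating problems are either bounded, and then a limit of them does the job, or they can be normalised to a limit
  of norm 1, which the qualification condition excludes.

  For the projectional coderivative one applies this chain rule at each of the points that approach \<open>(x, u)\<close>.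
  There the condition needed is one on unprojected normals; it follows from the given one because \<open>0\<close>
  is its own projection on a tangent cone (\<open>qualification_nearby\<close>). Projections on cones are
  positively homogeneous, so the alternative of bounded or normalised multipliers works once
  more, for the projected vectors.

  For the equality, let \<open>(z, - u')\<close> and \<open>(v, - z)\<close> be normals as above. Lipschitz continuity makes \<open>v\<close>
  a limiting subgradient of the scalar function \<open>z \<bullet> F\<close> on \<open>X\<close>, and regularity makes it a true first-order
  lower bound. Adding the corresponding inequality for \<open>(z, - u')\<close> shows that \<open>(v, - u')\<close> is a regular
  normal of the composed graph (\<open>regular_chain_rule\<close>). With the chain rule this gives graphical
  regularity. On a manifold, a projection on a tangent space only subtracts a normal of \<open>X\<close>, which is also
  a horizontal normal of the graph of \<open>F\<close> on \<open>X\<close>. Hence an element \<open>t'\<close> of the projectional coderivative of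
  \<open>F\<close> at \<open>z\<close> is tangent to \<open>X\<close> at \<open>x\<close> and \<open>(t', - z)\<close> is a normal of that graph
  (\<open>proj_coderivative_manifold\<close>); so \<open>(t', - u')\<close> is a normal of the composed graph, and \<open>t'\<close>, being its own
  projection, lies in the projectional coderivative of the composition.
\<close>

section \<open>Regular and limiting normal cones\<close>

lemma norm_diff_squared:
  fixes a b :: "'a::real_inner"
  shows "(norm (a - b))\<^sup>2 = (norm a)\<^sup>2 - 2 * (a \<bullet> b) + (norm b)\<^sup>2"
  using dot_norm_neg[of a b] by (simp add: field_simps)

lemma LIMSEQ_if_norm_less_inverse:
  fixes a :: "nat \<Rightarrow> 'a::real_normed_vector"
  assumes "\<And>k. norm (a k - b) < inverse (real (Suc k))"
  shows "a \<longlonglongrightarrow> b"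
  using assms by (intro metric_tendsto_imp_tendsto[OF LIMSEQ_inverse_real_of_nat])
    (auto simp: dist_norm less_imp_le)

lemma regular_normal_cone_iff:
  fixes C :: "'a::euclidean_space set"
  shows "v \<in> regular_normal_cone C x \<longleftrightarrow>
    x \<in> C \<and> (\<forall>\<epsilon>>0. \<exists>\<delta>>0. \<forall>y\<in>C. norm (y - x) < \<delta> \<longrightarrow> v \<bullet> (y - x) \<le> \<epsilon> * norm (y - x))"
    (is "_ \<longleftrightarrow> x \<in> C \<and> ?R")
proof -
  have "Limsup (at x within C) (\<lambda>y. ereal ((v \<bullet> (y - x)) / norm (y - x))) \<le> 0 \<longleftrightarrow> ?R"
    (is "?L \<longleftrightarrow> _")
  proof
    assume L: ?L
    show ?R
    proof (intro allI impI)
      fix \<epsilon> :: real assume "\<epsilon> > 0"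
      then have "ereal 0 < ereal \<epsilon>" by simp
      then have "\<forall>\<^sub>F y in at x within C. ereal ((v \<bullet> (y - x)) / norm (y - x)) < ereal \<epsilon>"
        using L unfolding Limsup_le_iff zero_ereal_def by blast
      then obtain d where "d > 0"
        and d: "\<And>y. y \<in> C \<Longrightarrow> y \<noteq> x \<Longrightarrow> dist y x < d \<Longrightarrow> (v \<bullet> (y - x)) / norm (y - x) < \<epsilon>"
        unfolding eventually_at by auto
      have "v \<bullet> (y - x) \<le> \<epsilon> * norm (y - x)" if "y \<in> C" "norm (y - x) < d" for y
        using d[of y] that by (cases "y = x") (auto simp: dist_norm divide_simps)
      then show "\<exists>\<delta>>0. \<forall>y\<in>C. norm (y - x) < \<delta> \<longrightarrow> v \<bullet> (y - x) \<le> \<epsilon> * norm (y - x)"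
        using \<open>d > 0\<close> by blast
    qed
  next
    assume R: ?R
    show ?L
      unfolding Limsup_le_iff
    proof (intro allI impI)
      fix c :: ereal assume "0 < c"
      then obtain e where "e > 0" and e: "ereal e < c"
        by (metis ereal_dense2 ereal_less(2))
      obtain d where "d > 0"
        and d: "\<And>y. y \<in> C \<Longrightarrow> norm (y - x) < d \<Longrightarrow> v \<bullet> (y - x) \<le> e * norm (y - x)"
        using R \<open>e > 0\<close> by meson
      have "(v \<bullet> (y - x)) / norm (y - x) \<le> e" if "y \<in> C" "y \<noteq> x" "dist y x < d" for y
        using d[of y] that by (auto simp: dist_norm divide_simps)
      then have "\<forall>\<^sub>F y in at x within C. ereal ((v \<bullet> (y - x)) / norm (y - x)) \<le> ereal e"
        unfolding eventually_at using \<open>d > 0\<close> by auto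
      then show "\<forall>\<^sub>F y in at x within C. ereal ((v \<bullet> (y - x)) / norm (y - x)) < c"
        using e by (auto elim!: eventually_mono intro: le_less_trans simp del: ereal_less_eq)
    qed
  qed
  then show ?thesis
    unfolding regular_normal_cone_def by auto
qed

lemma regular_normal_cone_add:
  fixes C :: "'a::euclidean_space set"
  assumes "v \<in> regular_normal_cone C x" and "w \<in> regular_normal_cone C x"
  shows "v + w \<in> regular_normal_cone C x"
  unfolding regular_normal_cone_iff
proof (intro conjI allI impI)
  show "x \<in> C" using assms by (simp add: regular_normal_cone_iff)
  fix \<epsilon> :: real assume "\<epsilon> > 0"
  then have "\<epsilon> / 2 > 0" by simp
  obtain d1 where "d1 > 0"
    and 1: "\<And>y. y \<in> C \<Longrightarrow> norm (y - x) < d1 \<Longrightarrow> v \<bullet> (y - x) \<le> \<epsilon> / 2 * norm (y - x)"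
    using assms(1) \<open>\<epsilon> / 2 > 0\<close> unfolding regular_normal_cone_iff by blast
  obtain d2 where "d2 > 0"
    and 2: "\<And>y. y \<in> C \<Longrightarrow> norm (y - x) < d2 \<Longrightarrow> w \<bullet> (y - x) \<le> \<epsilon> / 2 * norm (y - x)"
    using assms(2) \<open>\<epsilon> / 2 > 0\<close> unfolding regular_normal_cone_iff by blast
  have "(v + w) \<bullet> (y - x) \<le> \<epsilon> * norm (y - x)" if "y \<in> C" "norm (y - x) < min d1 d2" for y
    using 1[of y] 2[of y] that by (simp add: inner_add_left)
  then show "\<exists>\<delta>>0. \<forall>y\<in>C. norm (y - x) < \<delta> \<longrightarrow> (v + w) \<bullet> (y - x) \<le> \<epsilon> * norm (y - x)"
    using \<open>d1 > 0\<close> \<open>d2 > 0\<close> by (intro exI[of _ "min d1 d2"]) auto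
qed

lemma regular_normal_cone_scale:
  fixes C :: "'a::euclidean_space set"
  assumes "v \<in> regular_normal_cone C x" and "c > 0"
  shows "c *\<^sub>R v \<in> regular_normal_cone C x"
  unfolding regular_normal_cone_iff
proof (intro conjI allI impI)
  show "x \<in> C" using assms by (simp add: regular_normal_cone_iff)
  fix \<epsilon> :: real assume "\<epsilon> > 0"
  then have "\<epsilon> / c > 0" using assms by simp
  then obtain d where "d > 0"
    and d: "\<And>y. y \<in> C \<Longrightarrow> norm (y - x) < d \<Longrightarrow> v \<bullet> (y - x) \<le> \<epsilon> / c * norm (y - x)"
    using assms unfolding regular_normal_cone_iff by blast
  have "(c *\<^sub>R v) \<bullet> (y - x) \<le> \<epsilon> * norm (y - x)" if "y \<in> C" "norm (y - x) < d" for y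
    using d[OF that] \<open>c > 0\<close> by (simp add: field_simps)
  then show "\<exists>\<delta>>0. \<forall>y\<in>C. norm (y - x) < \<delta> \<longrightarrow> (c *\<^sub>R v) \<bullet> (y - x) \<le> \<epsilon> * norm (y - x)"
    using \<open>d > 0\<close> by blast
qed

lemma regular_normal_if_quadratic_bound:
  fixes C :: "'a::euclidean_space set"
  assumes "x \<in> C" and "r > 0"
    and bound: "\<And>y. y \<in> C \<Longrightarrow> norm (y - x) < r \<Longrightarrow> v \<bullet> (y - x) \<le> \<sigma> * (norm (y - x))\<^sup>2"
  shows "v \<in> regular_normal_cone C x"
  unfolding regular_normal_cone_iff
proof (intro conjI allI impI)
  fix \<epsilon> :: real assume "\<epsilon> > 0"
  define d where "d = min r (\<epsilon> / (\<bar>\<sigma>\<bar> + 1))"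
  have "d > 0" using \<open>r > 0\<close> \<open>\<epsilon> > 0\<close> by (simp add: d_def)
  have "v \<bullet> (y - x) \<le> \<epsilon> * norm (y - x)" if "y \<in> C" "norm (y - x) < d" for y
  proof -
    have "norm (y - x) * (\<bar>\<sigma>\<bar> + 1) \<le> \<epsilon>"
      using that by (simp add: d_def pos_less_divide_eq)
    then have "\<sigma> * norm (y - x) \<le> \<epsilon>"
      by (smt (verit, best) distrib_left mult.commute mult_right_mono norm_ge_zero)
    then have "\<sigma> * norm (y - x) * norm (y - x) \<le> \<epsilon> * norm (y - x)"
      by (intro mult_right_mono) auto
    moreover have "v \<bullet> (y - x) \<le> \<sigma> * (norm (y - x))\<^sup>2"
      using that by (intro bound) (auto simp: d_def)
    ultimately show ?thesis
      by (simp add: power2_eq_square mult.assoc)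
  qed
  then show "\<exists>\<delta>>0. \<forall>y\<in>C. norm (y - x) < \<delta> \<longrightarrow> v \<bullet> (y - x) \<le> \<epsilon> * norm (y - x)"
    using \<open>d > 0\<close> by blast
qed (use assms in auto)

text \<open>
  Choosing regular normals within \<open>1 / (k + 1)\<close> makes the sequences in the definition; in this form the
  diagonal arguments below need no sequences of sequences.
\<close>
lemma normal_cone_iff_approximable:
  fixes C :: "'a::euclidean_space set"
  shows "v \<in> normal_cone C x \<longleftrightarrow> x \<in> C \<and>
    (\<forall>\<epsilon>>0. \<exists>y w. w \<in> regular_normal_cone C y \<and> dist y x < \<epsilon> \<and> dist w v < \<epsilon>)"
    (is "_ \<longleftrightarrow> x \<in> C \<and> ?R")
proof (intro iffI conjI)
  assume "v \<in> normal_cone C x"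
  then obtain xs vs where "x \<in> C" and reg: "\<And>k::nat. vs k \<in> regular_normal_cone C (xs k)"
    and lim: "xs \<longlonglongrightarrow> x" "vs \<longlonglongrightarrow> v"
    unfolding normal_cone_def by auto
  show "x \<in> C" by fact
  show ?R
  proof (intro allI impI)
    fix \<epsilon> :: real assume "\<epsilon> > 0"
    then have "\<forall>\<^sub>F k in sequentially. dist (xs k) x < \<epsilon> \<and> dist (vs k) v < \<epsilon>"
      using lim by (intro eventually_conj tendstoD)
    then obtain k where "dist (xs k) x < \<epsilon> \<and> dist (vs k) v < \<epsilon>"
      using eventually_happens'[OF sequentially_bot] by blast
    then show "\<exists>y w. w \<in> regular_normal_cone C y \<and> dist y x < \<epsilon> \<and> dist w v < \<epsilon>"
      using reg by blast
  qed
next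
  assume R: "x \<in> C \<and> ?R"
  then have "\<exists>y w. w \<in> regular_normal_cone C y \<and> dist y x < inverse (real (Suc k))
      \<and> dist w v < inverse (real (Suc k))" for k
    by (meson inverse_positive_iff_positive of_nat_0_less_iff zero_less_Suc)
  then obtain xs vs where reg: "\<And>k. vs k \<in> regular_normal_cone C (xs k)"
    and d: "\<And>k. dist (xs k) x < inverse (real (Suc k))" "\<And>k. dist (vs k) v < inverse (real (Suc k))"
    by metis
  have "xs \<longlonglongrightarrow> x" "vs \<longlonglongrightarrow> v"
    using d by (auto intro!: LIMSEQ_if_norm_less_inverse simp: dist_norm)
  moreover have "xs k \<in> C" for k
    using reg by (simp add: regular_normal_cone_iff)
  ultimately show "v \<in> normal_cone C x"
    using R reg unfolding normal_cone_def by auto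
qed

lemma regular_normal_cone_subset_normal_cone:
  "regular_normal_cone C x \<subseteq> normal_cone (C :: 'a::euclidean_space set) x"
proof
  fix v assume "v \<in> regular_normal_cone C x"
  moreover from this have "x \<in> C" by (simp add: regular_normal_cone_iff)
  ultimately show "v \<in> normal_cone C x"
    unfolding normal_cone_iff_approximable by (metis dist_self)
qed

lemma normal_cone_limit:
  fixes C :: "'a::euclidean_space set"
  assumes "x \<in> C" and "xs \<longlonglongrightarrow> x" and "vs \<longlonglongrightarrow> v" and "\<And>k. vs k \<in> normal_cone C (xs k)"
  shows "v \<in> normal_cone C x"
  unfolding normal_cone_iff_approximable
proof (intro conjI allI impI)
  fix \<epsilon> :: real assume "\<epsilon> > 0"
  then have e: "\<epsilon> / 2 > 0" by simp
  then have "\<forall>\<^sub>F k in sequentially. dist (xs k) x < \<epsilon> / 2 \<and> dist (vs k) v < \<epsilon> / 2"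
    using assms(2,3) by (intro eventually_conj tendstoD)
  then obtain k where k: "dist (xs k) x < \<epsilon> / 2" "dist (vs k) v < \<epsilon> / 2"
    using eventually_happens'[OF sequentially_bot] by blast
  obtain y w where "w \<in> regular_normal_cone C y" "dist y (xs k) < \<epsilon> / 2" "dist w (vs k) < \<epsilon> / 2"
    using assms(4)[of k] e unfolding normal_cone_iff_approximable by meson
  then show "\<exists>y w. w \<in> regular_normal_cone C y \<and> dist y x < \<epsilon> \<and> dist w v < \<epsilon>"
    using k by (metis dist_triangle_half_l dist_commute)
qed fact

lemma normal_cone_scale:
  fixes C :: "'a::euclidean_space set"
  assumes "v \<in> normal_cone C x" and "c > 0"
  shows "c *\<^sub>R v \<in> normal_cone C x"
proof -
  obtain xs vs where "x \<in> C" and reg: "\<And>k::nat. vs k \<in> regular_normal_cone C (xs k)"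
    and lim: "xs \<longlonglongrightarrow> x" "vs \<longlonglongrightarrow> v"
    using assms unfolding normal_cone_def by auto
  show ?thesis
  proof (rule normal_cone_limit[OF \<open>x \<in> C\<close> lim(1)])
    show "(\<lambda>k. c *\<^sub>R vs k) \<longlonglongrightarrow> c *\<^sub>R v" by (intro tendsto_intros lim)
    show "\<And>k. c *\<^sub>R vs k \<in> normal_cone C (xs k)"
      using regular_normal_cone_scale[OF reg \<open>c > 0\<close>] regular_normal_cone_subset_normal_cone by blast
  qed
qed

text \<open>
  Suppose that \<open>v\<close> violates the inequality of a regular normal at \<open>x\<close> by at most \<open>\<epsilon> * norm (y - x)\<close>. Project
  \<open>x + t v\<close> on \<open>C\<close> for small \<open>t > 0\<close>: comparing the nearest point \<open>x'\<close> with \<open>x\<close> gives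
  \<open>norm (x' - x)\<^sup>2 \<le> 2 t v \<bullet> (x' - x) \<le> 2 t \<epsilon> norm (x' - x)\<close>, so the proximal normal \<open>v' = (x + t v - x') / t\<close>
  differs from \<open>v\<close> by \<open>(x - x') / t\<close>, of norm at most \<open>2 \<epsilon>\<close>. A proximal normal satisfies the inequality with a
  quadratic error on a whole neighbourhood, and this is what the penalty argument for the chain rule
  needs. Positive \<open>\<epsilon>\<close> serve to show that approximate normals with errors tending to \<open>0\<close> converge to normals.
\<close>
lemma proximal_normal_near_almost_normal:
  fixes C :: "'a::euclidean_space set"
  assumes "x \<in> C" and "r > 0" and cl: "closed (C \<inter> cball x r)" and "\<epsilon> \<ge> 0" and "\<delta> > 0"
    and "\<eta> > 0" and almost: "\<And>y. y \<in> C \<Longrightarrow> norm (y - x) < \<eta> \<Longrightarrow> v \<bullet> (y - x) \<le> \<epsilon> * norm (y - x)"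
  obtains x' v' \<sigma> where "x' \<in> C" "norm (x' - x) < \<delta>" "norm (v' - v) \<le> 2 * \<epsilon>"
    "\<And>y. y \<in> C \<inter> cball x r \<Longrightarrow> v' \<bullet> (y - x') \<le> \<sigma> * (norm (y - x'))\<^sup>2"
proof -
  define t where "t = min \<eta> (min \<delta> r) / (2 * norm v + 1)"
  have pos: "2 * norm v + 1 > 0"
    using norm_ge_zero[of v] by linarith
  have "t > 0" using \<open>\<eta> > 0\<close> \<open>\<delta> > 0\<close> \<open>r > 0\<close> pos by (auto simp: t_def)
  have tb: "t * (2 * norm v + 1) = min \<eta> (min \<delta> r)" using pos by (simp add: t_def)
  define q where "q = x + t *\<^sub>R v"
  obtain x' where x': "x' \<in> C \<inter> cball x r"
    and near: "\<And>y. y \<in> C \<inter> cball x r \<Longrightarrow> dist q x' \<le> dist q y"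
  proof (rule distance_attains_inf[OF cl])
    show "C \<inter> cball x r \<noteq> {}" using \<open>x \<in> C\<close> \<open>r > 0\<close> by fastforce
  qed blast
  define v' where "v' = (q - x') /\<^sub>R t"
  have vv: "v' - v = (x - x') /\<^sub>R t"
    using \<open>t > 0\<close> by (simp add: v'_def q_def field_simps scaleR_add_right scaleR_diff_right)
  have "dist q x' \<le> dist q x"
    using near[of x] \<open>x \<in> C\<close> \<open>r > 0\<close> by auto
  also have qx: "dist q x = t * norm v"
    using \<open>t > 0\<close> by (simp add: q_def dist_norm)
  finally have qx': "dist q x' \<le> t * norm v" .
  have "norm (x' - x) \<le> 2 * t * norm v"
    using dist_triangle[of x' x q] qx qx' by (simp add: dist_norm norm_minus_commute)
  moreover have "t * (2 * norm v + 1) = 2 * t * norm v + t"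
    by (simp add: distrib_left)
  moreover have "min \<eta> (min \<delta> r) \<le> \<eta>" "min \<eta> (min \<delta> r) \<le> \<delta>"
    by simp_all
  ultimately have small: "norm (x' - x) < \<eta>" "norm (x' - x) < \<delta>"
    using \<open>t > 0\<close> tb by linarith+
  have "(dist q x')\<^sup>2 \<le> (t * norm v)\<^sup>2"
    using qx' by (intro power_mono) auto
  moreover have "(dist q x')\<^sup>2 = (t * norm v)\<^sup>2 - 2 * (t * (v \<bullet> (x' - x))) + (norm (x' - x))\<^sup>2"
  proof -
    have "q - x' = t *\<^sub>R v - (x' - x)" by (simp add: q_def)
    moreover have "norm (t *\<^sub>R v) = t * norm v" using \<open>t > 0\<close> by simp
    ultimately show ?thesis
      by (simp only: dist_norm norm_diff_squared[of "t *\<^sub>R v" "x' - x"] inner_scaleR_left)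
  qed
  ultimately have *: "(norm (x' - x))\<^sup>2 \<le> 2 * (t * (v \<bullet> (x' - x)))"
    by linarith
  have "norm (x' - x) * norm (x' - x) \<le> (2 * t * \<epsilon>) * norm (x' - x)"
  proof -
    have "v \<bullet> (x' - x) \<le> \<epsilon> * norm (x' - x)"
      using almost x' small(1) by blast
    then have "t * (v \<bullet> (x' - x)) \<le> t * (\<epsilon> * norm (x' - x))"
      using \<open>t > 0\<close> by (simp only: mult_le_cancel_left_pos)
    with * show ?thesis
      unfolding power2_eq_square mult.assoc by linarith
  qed
  then have "norm (x' - x) \<le> 2 * t * \<epsilon>"
    using \<open>t > 0\<close> \<open>\<epsilon> \<ge> 0\<close> by (cases "x' = x") simp_all
  then have "norm (v' - v) \<le> 2 * \<epsilon>"
    using \<open>t > 0\<close> by (simp add: vv norm_minus_commute pos_divide_le_eq divide_inverse_commute[symmetric] mult.commute mult.left_commute)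
  moreover have "v' \<bullet> (y - x') \<le> inverse (2 * t) * (norm (y - x'))\<^sup>2" if "y \<in> C \<inter> cball x r" for y
  proof -
    have "(dist q x')\<^sup>2 \<le> (dist q y)\<^sup>2"
      using near[OF that] by (intro power_mono) auto
    moreover have "(dist q y)\<^sup>2 = (dist q x')\<^sup>2 - 2 * ((q - x') \<bullet> (y - x')) + (norm (y - x'))\<^sup>2"
    proof -
      have "q - y = (q - x') - (y - x')" by simp
      then show ?thesis
        by (simp only: dist_norm norm_diff_squared[of "q - x'" "y - x'"])
    qed
    ultimately have "2 * ((q - x') \<bullet> (y - x')) \<le> (norm (y - x'))\<^sup>2" by simp
    then show ?thesis
      using \<open>t > 0\<close> by (simp add: v'_def divide_simps mult_ac)
  qed
  ultimately show thesis
    using that x' small by blast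
qed

section \<open>The chain rule for limiting normals\<close>

lemma norm_squared_recentre:
  fixes a b c :: "'a::real_inner"
  shows "(norm (a - c))\<^sup>2 = (norm (b - c))\<^sup>2 + 2 * ((b - c) \<bullet> (a - b)) + (norm (a - b))\<^sup>2"
proof -
  have "a - c = (b - c) - (b - a)" by simp
  then have "(norm (a - c))\<^sup>2 = (norm (b - c))\<^sup>2 - 2 * ((b - c) \<bullet> (b - a)) + (norm (b - a))\<^sup>2"
    by (simp only: norm_diff_squared[of "b - c" "b - a"])
  moreover have "(b - c) \<bullet> (b - a) = - ((b - c) \<bullet> (a - b))"
    by (simp only: minus_diff_eq flip: inner_minus_right)
  ultimately show ?thesis
    by (simp add: norm_minus_commute)
qed

lemma norm_Pair_squared:
  "(norm (a, b))\<^sup>2 = (norm a)\<^sup>2 + (norm b)\<^sup>2"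
  by (simp add: norm_Pair)

lemma mem_gph_iff: "(y, w) \<in> gph S \<longleftrightarrow> w \<in> S y"
  by (simp add: gph_def)

lemma gph_restr_single_valued:
  "gph (restr (single_valued_map F) X) = {(y, w). y \<in> X \<and> w = F y}"
  by (auto simp: gph_def restr_def single_valued_map_def split: if_splits)

lemma gph_restr_comp_single_valued:
  "gph (restr (comp_map S\<^sub>0 (single_valued_map F)) X) = {(y, s). y \<in> X \<and> s \<in> S\<^sub>0 (F y)}"
  by (auto simp: gph_def restr_def single_valued_map_def comp_map_def split: if_splits)

text \<open>
  A proximal normal \<open>(v, q)\<close> of the graph of the composition at \<open>(x, u)\<close> is split by a penalty method. The
  intermediate value \<open>w\<close> becomes a free variable, and one minimises
  \<open>2 \<tau> (norm (y - x)\<^sup>2 + norm (s - u)\<^sup>2) - v \<bullet> (y - x) - q \<bullet> (s - u) + k norm (F y - w)\<^sup>2\<close> over the \<open>y\<close> in \<open>X\<close> and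
  the \<open>(w, s)\<close> in the graph of \<open>S\<^sub>0\<close> in a compact box. As \<open>k\<close> grows, the minimisers converge to \<open>(x, F x, u)\<close>,
  because the quadratic bound makes this the only minimiser of the problem with the constraint \<open>w = F y\<close>.
  At an interior minimiser, varying \<open>y\<close> alone gives a regular normal of the graph of \<open>F\<close> on \<open>X\<close>, and varying
  \<open>(w, s)\<close> alone one of the graph of \<open>S\<^sub>0\<close>; the gradient \<open>z = 2 k (F y - w)\<close> of the penalty is the multiplier
  that they share.
\<close>
lemma proximal_chain_rule:
  fixes F :: "'a::euclidean_space \<Rightarrow> 'b::euclidean_space"
    and S\<^sub>0 :: "('b, 'c::euclidean_space) setmap"
  assumes "closed X" and clS: "closed (gph S\<^sub>0)" and "r > 0"
    and contF: "continuous_on (X \<inter> cball x r) F" and "x \<in> X" and "u \<in> S\<^sub>0 (F x)"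
    and prox: "\<And>y s. y \<in> X \<Longrightarrow> s \<in> S\<^sub>0 (F y) \<Longrightarrow> norm (y - x) \<le> r \<Longrightarrow> norm (s - u) \<le> r \<Longrightarrow>
      v \<bullet> (y - x) + q \<bullet> (s - u) \<le> \<sigma> * ((norm (y - x))\<^sup>2 + (norm (s - u))\<^sup>2)"
    and "\<epsilon> > 0"
  obtains y w s v' z q'
  where "(v', - z) \<in> regular_normal_cone (gph (restr (single_valued_map F) X)) (y, F y)"
    and "(z, q') \<in> regular_normal_cone (gph S\<^sub>0) (w, s)"
    and "norm (y - x) < \<epsilon>" "norm (w - F x) < \<epsilon>" "norm (s - u) < \<epsilon>"
    and "norm (v' - v) < \<epsilon>" "norm (q' - q) < \<epsilon>"
proof -
  define \<tau> where "\<tau> = \<bar>\<sigma>\<bar> + 1"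
  have "\<tau> > 0" "\<sigma> \<le> \<tau>" by (auto simp: \<tau>_def)
  define D where "D = (X \<inter> cball x r) \<times> (gph S\<^sub>0 \<inter> (cball (F x) r \<times> cball u r))"
  have "compact D"
    unfolding D_def using \<open>closed X\<close> clS
    by (intro compact_Times closed_Int_compact) auto
  have xD: "(x, F x, u) \<in> D"
    using \<open>x \<in> X\<close> \<open>u \<in> S\<^sub>0 (F x)\<close> \<open>r > 0\<close> by (auto simp: D_def gph_def)
  define base where "base p = 2 * \<tau> * ((norm (fst p - x))\<^sup>2 + (norm (snd (snd p) - u))\<^sup>2)
      - v \<bullet> (fst p - x) - q \<bullet> (snd (snd p) - u)" for p :: "'a \<times> 'b \<times> 'c"
  define gap where "gap p = (norm (F (fst p) - fst (snd p)))\<^sup>2" for p :: "'a \<times> 'b \<times> 'c"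
  have cont_base: "continuous_on D base"
    unfolding base_def by (intro continuous_intros)
  have "continuous_on D (\<lambda>p. F (fst p))"
    by (rule continuous_on_compose2[OF contF continuous_on_fst[OF continuous_on_id]]) (auto simp: D_def)
  then have cont_gap: "continuous_on D gap"
    unfolding gap_def by (intro continuous_intros)
  have "\<exists>p\<in>D. \<forall>p'\<in>D. base p + real k * gap p \<le> base p' + real k * gap p'" for k :: nat
    using \<open>compact D\<close> xD cont_base cont_gap
    by (intro continuous_attains_inf) (auto intro: continuous_on_add continuous_on_mult_left)
  then obtain P where PD: "\<And>k. P k \<in> D"
    and Pmin: "\<And>k p'. p' \<in> D \<Longrightarrow> base (P k) + real k * gap (P k) \<le> base p' + real k * gap p'"
    by metis
  have P0: "base (P k) + real k * gap (P k) \<le> 0" for k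
    using Pmin[OF xD, of k] by (simp add: base_def gap_def)
  have gap_nonneg: "gap p \<ge> 0" for p by (simp add: gap_def)
  obtain l h where "l \<in> D" and h: "strict_mono (h :: nat \<Rightarrow> nat)" and lim: "(P \<circ> h) \<longlonglongrightarrow> l"
    using \<open>compact D\<close> PD unfolding compact_def by blast
  obtain p0 where p0: "\<And>p. p \<in> D \<Longrightarrow> base p0 \<le> base p"
    using continuous_attains_inf[OF \<open>compact D\<close> _ cont_base] xD by blast
  have lim_base: "(\<lambda>k. base (P (h k))) \<longlonglongrightarrow> base l" and lim_gap: "(\<lambda>k. gap (P (h k))) \<longlonglongrightarrow> gap l"
    using cont_base cont_gap \<open>l \<in> D\<close> PD lim unfolding continuous_on_sequentially by (auto simp: o_def)
  \<comment> \<open>Boundedness of \<open>base\<close> from below forces the constraint violation \<open>gap\<close> to vanish at rate \<open>1 / k\<close>.\<close>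
  have "gap (P (h k)) \<le> - base p0 * inverse (real k)" if "k \<ge> 1" for k
  proof -
    have "real k * gap (P (h k)) \<le> real (h k) * gap (P (h k))"
      using seq_suble[OF h, of k] gap_nonneg by (intro mult_right_mono) auto
    also have "\<dots> \<le> - base p0"
      using P0[of "h k"] p0[OF PD[of "h k"]] by linarith
    finally show ?thesis
      using that by (simp add: field_simps)
  qed
  then have "\<forall>\<^sub>F k in sequentially. gap (P (h k)) \<le> - base p0 * inverse (real k)"
    using eventually_ge_at_top by (rule eventually_mono[rotated])
  moreover have "(\<lambda>k. - base p0 * inverse (real k)) \<longlonglongrightarrow> - base p0 * 0"
    by (intro tendsto_intros lim_inverse_n)
  ultimately have "gap l \<le> - base p0 * 0"
    using lim_gap by (intro tendsto_le[OF sequentially_bot]) auto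
  then have Fl: "F (fst l) = fst (snd l)"
    by (simp add: gap_def)
  have "base (P (h k)) \<le> 0" for k
  proof -
    have "0 \<le> real (h k) * gap (P (h k))" using gap_nonneg by simp
    then show ?thesis using P0[of "h k"] by linarith
  qed
  then have "base l \<le> 0"
    using LIMSEQ_le_const2[OF lim_base] by blast
  moreover have "v \<bullet> (fst l - x) + q \<bullet> (snd (snd l) - u)
      \<le> \<tau> * ((norm (fst l - x))\<^sup>2 + (norm (snd (snd l) - u))\<^sup>2)" (is "_ \<le> \<tau> * ?A")
  proof -
    have "v \<bullet> (fst l - x) + q \<bullet> (snd (snd l) - u) \<le> \<sigma> * ?A"
      using \<open>l \<in> D\<close> Fl by (intro prox) (auto simp: D_def gph_def dist_norm norm_minus_commute)
    also have "\<dots> \<le> \<tau> * ?A"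
      using \<open>\<sigma> \<le> \<tau>\<close> by (intro mult_right_mono) auto
    finally show ?thesis .
  qed
  \<comment> \<open>The factor 2 in \<open>base\<close> outweighs the bound, so that \<open>l\<close> can only be the base point.\<close>
  ultimately have "\<tau> * ?A \<le> 0"
    unfolding base_def by linarith
  then have "?A \<le> 0"
    using \<open>\<tau> > 0\<close> by (simp add: mult_le_0_iff)
  then have "(norm (fst l - x))\<^sup>2 = 0" "(norm (snd (snd l) - u))\<^sup>2 = 0"
    using zero_le_power2[of "norm (fst l - x)"] zero_le_power2[of "norm (snd (snd l) - u)"]
    by linarith+
  then have l: "l = (x, F x, u)"
    using Fl by (simp add: prod_eq_iff)
  \<comment> \<open>The gradient of the quadratic term at distance less than \<open>\<rho>\<close> from \<open>(x, u)\<close> is shorter than \<open>\<epsilon>\<close>.\<close>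
  define \<rho> where "\<rho> = min r (min \<epsilon> (\<epsilon> / (4 * \<tau>)))"
  have "\<rho> > 0" using \<open>r > 0\<close> \<open>\<epsilon> > 0\<close> \<open>\<tau> > 0\<close> by (simp add: \<rho>_def)
  have \<rho>: "\<rho> \<le> r" "\<rho> \<le> \<epsilon>" by (simp_all add: \<rho>_def)
  have "\<rho> \<le> \<epsilon> / (4 * \<tau>)" by (simp add: \<rho>_def)
  then have \<rho>_small: "4 * \<tau> * \<rho> \<le> \<epsilon>"
    using \<open>\<tau> > 0\<close> by (simp add: pos_le_divide_eq mult.commute)
  have "\<forall>\<^sub>F k in sequentially. dist (P (h k)) l < \<rho>"
    using tendstoD[OF lim \<open>\<rho> > 0\<close>] by simp
  then obtain k where k: "dist (P (h k)) l < \<rho>"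
    using eventually_happens'[OF sequentially_bot] by blast
  define K where "K = real (h k)"
  have "K \<ge> 0" by (simp add: K_def)
  obtain y w s where P: "P (h k) = (y, w, s)" by (cases "P (h k)") auto
  have "y \<in> X" "s \<in> S\<^sub>0 w"
    using PD[of "h k"] by (auto simp: P D_def gph_def)
  have ny: "norm (y - x) < \<rho>" and nw: "norm (w - F x) < \<rho>" and ns: "norm (s - u) < \<rho>"
  proof -
    have "dist y x \<le> dist (y, w, s) l" "dist (w, s) (F x, u) \<le> dist (y, w, s) l"
      using dist_fst_le[of "(y, w, s)" l] dist_snd_le[of "(y, w, s)" l] by (auto simp: l)
    moreover have "dist w (F x) \<le> dist (w, s) (F x, u)" "dist s u \<le> dist (w, s) (F x, u)"
      using dist_fst_le[of "(w, s)" "(F x, u)"] dist_snd_le[of "(w, s)" "(F x, u)"] by auto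
    ultimately show "norm (y - x) < \<rho>" "norm (w - F x) < \<rho>" "norm (s - u) < \<rho>"
      using k by (auto simp: P dist_norm)
  qed
  have yws: "(y, w, s) \<in> D" using PD[of "h k"] P by simp
  have minimal: "base (y, w, s) + K * gap (y, w, s) \<le> base p' + K * gap p'" if "p' \<in> D" for p'
    using Pmin[OF that, of "h k"] by (simp add: P K_def)
  define v' where "v' = v - (4 * \<tau>) *\<^sub>R (y - x)"
  define q' where "q' = q - (4 * \<tau>) *\<^sub>R (s - u)"
  define z where "z = (2 * K) *\<^sub>R (F y - w)"
  have "(v', - z) \<in> regular_normal_cone (gph (restr (single_valued_map F) X)) (y, F y)"
  proof (rule regular_normal_if_quadratic_bound)
    show "(y, F y) \<in> gph (restr (single_valued_map F) X)"
      using \<open>y \<in> X\<close> by (simp add: gph_restr_single_valued)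
    show "r - norm (y - x) > 0" using ny \<rho> by simp
    fix p' assume "p' \<in> gph (restr (single_valued_map F) X)"
      and small: "norm (p' - (y, F y)) < r - norm (y - x)"
    then obtain y' where "y' \<in> X" and p': "p' = (y', F y')"
      by (auto simp: gph_restr_single_valued)
    have "norm (y' - y) \<le> norm (p' - (y, F y))"
      using norm_fst_le[of "y' - y" "F y' - F y"] by (simp add: p')
    then have "norm (y' - x) \<le> r"
      using small norm_triangle_ineq[of "y' - y" "y - x"] by simp
    then have "(y', w, s) \<in> D"
      using yws \<open>y' \<in> X\<close> by (auto simp: D_def dist_norm norm_minus_commute)
    note min = minimal[OF this]
    have 1: "2 * \<tau> * (norm (y' - x))\<^sup>2
        = 2 * \<tau> * (norm (y - x))\<^sup>2 + 4 * \<tau> * ((y - x) \<bullet> (y' - y)) + 2 * \<tau> * (norm (y' - y))\<^sup>2"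
      unfolding norm_squared_recentre[of y' x y] by (simp add: algebra_simps)
    have 2: "K * (norm (F y' - w))\<^sup>2
        = K * (norm (F y - w))\<^sup>2 + 2 * K * ((F y - w) \<bullet> (F y' - F y)) + K * (norm (F y' - F y))\<^sup>2"
      unfolding norm_squared_recentre[of "F y'" w "F y"] by (simp add: algebra_simps)
    have 3: "v \<bullet> (y' - x) = v \<bullet> (y - x) + v \<bullet> (y' - y)"
      by (simp add: inner_diff_right)
    have "v \<bullet> (y' - y) - 4 * \<tau> * ((y - x) \<bullet> (y' - y)) - 2 * K * ((F y - w) \<bullet> (F y' - F y))
        \<le> 2 * \<tau> * (norm (y' - y))\<^sup>2 + K * (norm (F y' - F y))\<^sup>2"
      using min unfolding base_def gap_def fst_conv snd_conv distrib_left 1 2 3 by linarith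
    also have "\<dots> \<le> (2 * \<tau> + K) * (norm (y' - y))\<^sup>2 + (2 * \<tau> + K) * (norm (F y' - F y))\<^sup>2"
      using \<open>K \<ge> 0\<close> \<open>\<tau> > 0\<close> by (intro add_mono mult_right_mono) auto
    finally show "(v', - z) \<bullet> (p' - (y, F y)) \<le> (2 * \<tau> + K) * (norm (p' - (y, F y)))\<^sup>2"
      by (simp only: p' v'_def z_def norm_Pair_squared distrib_left diff_Pair inner_Pair
          inner_diff_left[of v] inner_minus_left inner_scaleR_left)
  qed
  moreover have "(z, q') \<in> regular_normal_cone (gph S\<^sub>0) (w, s)"
  proof (rule regular_normal_if_quadratic_bound)
    show "(w, s) \<in> gph S\<^sub>0"
      using \<open>s \<in> S\<^sub>0 w\<close> by (simp add: gph_def)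
    show "min (r - norm (w - F x)) (r - norm (s - u)) > 0" using nw ns \<rho> by simp
    fix p' assume "p' \<in> gph S\<^sub>0"
      and small: "norm (p' - (w, s)) < min (r - norm (w - F x)) (r - norm (s - u))"
    obtain w' s' where p': "p' = (w', s')" by (cases p') auto
    have "norm (w' - w) \<le> norm (p' - (w, s))" "norm (s' - s) \<le> norm (p' - (w, s))"
      using norm_fst_le[of "w' - w" "s' - s"] norm_snd_le[of "s' - s" "w' - w"] by (simp_all add: p')
    then have "norm (w' - F x) \<le> r" "norm (s' - u) \<le> r"
      using small norm_triangle_ineq[of "w' - w" "w - F x"] norm_triangle_ineq[of "s' - s" "s - u"]
      by simp_all
    then have "(y, w', s') \<in> D"
      using yws \<open>p' \<in> gph S\<^sub>0\<close> by (auto simp: D_def dist_norm norm_minus_commute p')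
    note min = minimal[OF this]
    have 1: "2 * \<tau> * (norm (s' - u))\<^sup>2
        = 2 * \<tau> * (norm (s - u))\<^sup>2 + 4 * \<tau> * ((s - u) \<bullet> (s' - s)) + 2 * \<tau> * (norm (s' - s))\<^sup>2"
      unfolding norm_squared_recentre[of s' u s] by (simp add: algebra_simps)
    have 2: "K * (norm (F y - w'))\<^sup>2
        = K * (norm (F y - w))\<^sup>2 - 2 * K * ((F y - w) \<bullet> (w' - w)) + K * (norm (w' - w))\<^sup>2"
    proof -
      have "F y - w' = (F y - w) - (w' - w)" by simp
      then have "(norm (F y - w'))\<^sup>2
          = (norm (F y - w))\<^sup>2 - 2 * ((F y - w) \<bullet> (w' - w)) + (norm (w' - w))\<^sup>2"
        by (simp only: norm_diff_squared[of "F y - w" "w' - w"])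
      then show ?thesis by (simp only:) (simp add: algebra_simps)
    qed
    have 3: "q \<bullet> (s' - u) = q \<bullet> (s - u) + q \<bullet> (s' - s)"
      by (simp add: inner_diff_right)
    have "2 * K * ((F y - w) \<bullet> (w' - w)) + (q \<bullet> (s' - s) - 4 * \<tau> * ((s - u) \<bullet> (s' - s)))
        \<le> K * (norm (w' - w))\<^sup>2 + 2 * \<tau> * (norm (s' - s))\<^sup>2"
      using min unfolding base_def gap_def fst_conv snd_conv distrib_left 1 2 3 by linarith
    also have "\<dots> \<le> (2 * \<tau> + K) * (norm (w' - w))\<^sup>2 + (2 * \<tau> + K) * (norm (s' - s))\<^sup>2"
      using \<open>K \<ge> 0\<close> \<open>\<tau> > 0\<close> by (intro add_mono mult_right_mono) auto
    finally show "(z, q') \<bullet> (p' - (w, s)) \<le> (2 * \<tau> + K) * (norm (p' - (w, s)))\<^sup>2"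
      by (simp only: p' q'_def z_def norm_Pair_squared distrib_left diff_Pair inner_Pair
          inner_diff_left[of q] inner_minus_left inner_scaleR_left)
  qed
  moreover have "norm (v' - v) < \<epsilon>" "norm (q' - q) < \<epsilon>"
  proof -
    have "4 * \<tau> * norm (y - x) < 4 * \<tau> * \<rho>" "4 * \<tau> * norm (s - u) < 4 * \<tau> * \<rho>"
      using ny ns \<open>\<tau> > 0\<close> by simp_all
    moreover have "norm (v' - v) = 4 * \<tau> * norm (y - x)" "norm (q' - q) = 4 * \<tau> * norm (s - u)"
      using \<open>\<tau> > 0\<close> by (simp_all add: v'_def q'_def)
    ultimately show "norm (v' - v) < \<epsilon>" "norm (q' - q) < \<epsilon>"
      using \<rho>_small by linarith+
  qed
  ultimately show thesis
    using that ny nw ns \<rho> by (meson less_le_trans)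
qed

lemma closed_gph_if_osc:
  fixes S :: "('a::metric_space, 'b::metric_space) setmap"
  assumes "outer_semicontinuous S"
  shows "closed (gph S)"
  unfolding closed_sequential_limits
proof (intro allI impI)
  fix p and l :: "'a \<times> 'b" assume p: "(\<forall>k. p k \<in> gph S) \<and> p \<longlonglongrightarrow> l"
  have "(\<lambda>k. fst (p k)) \<longlonglongrightarrow> fst l" "(\<lambda>k. snd (p k)) \<longlonglongrightarrow> snd l"
    using p by (auto intro: tendsto_fst tendsto_snd)
  moreover have "snd (p k) \<in> S (fst (p k))" for k
    using p by (auto simp: gph_def case_prod_unfold)
  ultimately have "snd l \<in> outer_limit (nhds (fst l)) S"
    unfolding outer_limit_def by (auto intro!: exI[of _ "\<lambda>k. fst (p k)"] exI[of _ "\<lambda>k. snd (p k)"])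
  then show "l \<in> gph S"
    using assms by (auto simp: outer_semicontinuous_def gph_def case_prod_unfold)
qed

lemma closed_gph_comp_over:
  fixes F :: "'a::metric_space \<Rightarrow> 'b::metric_space"
    and S\<^sub>0 :: "('b, 'c::metric_space) setmap"
  assumes "closed (X \<inter> A)" and "closed (gph S\<^sub>0)" and "continuous_on (X \<inter> A) F"
  shows "closed (gph (restr (comp_map S\<^sub>0 (single_valued_map F)) X) \<inter> A \<times> UNIV)"
proof -
  have "continuous_on ((X \<inter> A) \<times> UNIV) (\<lambda>p. F (fst p))"
    by (rule continuous_on_compose2[OF assms(3) continuous_on_fst[OF continuous_on_id]]) auto
  then have "closed (((X \<inter> A) \<times> UNIV) \<inter> (\<lambda>p. (F (fst p), snd p)) -` gph S\<^sub>0)"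
    using assms
    by (intro continuous_closed_preimage continuous_on_Pair closed_Times continuous_on_snd
        continuous_on_id) auto
  also have "((X \<inter> A) \<times> UNIV) \<inter> (\<lambda>p. (F (fst p), snd p)) -` gph S\<^sub>0
      = gph (restr (comp_map S\<^sub>0 (single_valued_map F)) X) \<inter> A \<times> UNIV"
    unfolding gph_restr_comp_single_valued by (auto simp: mem_gph_iff)
  finally show ?thesis .
qed

text \<open>
  A limiting normal is close to a regular one, that one is close to a proximal one, and the proximal
  one splits. The multiplier \<open>z\<close> need not stay bounded as \<open>\<epsilon>\<close> tends to \<open>0\<close>; controlling it is
  the purpose of the qualification condition below.
\<close>
lemma fuzzy_chain_rule:
  fixes F :: "'a::euclidean_space \<Rightarrow> 'b::euclidean_space"
    and S\<^sub>0 :: "('b, 'c::euclidean_space) setmap"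
  assumes "closed X" and clS: "closed (gph S\<^sub>0)"
    and "open V" and "x \<in> V" and contF: "continuous_on (X \<inter> V) F"
    and normal: "(v, q) \<in> normal_cone (gph (restr (comp_map S\<^sub>0 (single_valued_map F)) X)) (x, u)"
    and "\<epsilon> > 0"
  obtains y w s v' z q'
  where "(v', - z) \<in> regular_normal_cone (gph (restr (single_valued_map F) X)) (y, F y)"
    and "(z, q') \<in> regular_normal_cone (gph S\<^sub>0) (w, s)"
    and "norm (y - x) < \<epsilon>" "norm (w - F x) < \<epsilon>" "norm (s - u) < \<epsilon>"
    and "norm (v' - v) < \<epsilon>" "norm (q' - q) < \<epsilon>"
proof -
  let ?H = "gph (restr (comp_map S\<^sub>0 (single_valued_map F)) X)"
  have "(x, u) \<in> ?H"
    using normal by (simp add: normal_cone_def)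
  then have "x \<in> X" "u \<in> S\<^sub>0 (F x)" by (auto simp: gph_restr_comp_single_valued)
  obtain R where "R > 0" and R: "cball x R \<subseteq> V"
    using \<open>open V\<close> \<open>x \<in> V\<close> open_contains_cball by blast
  obtain \<omega> where "\<omega> > 0" and \<omega>: "\<And>y. y \<in> X \<inter> V \<Longrightarrow> dist y x < \<omega> \<Longrightarrow> dist (F y) (F x) < \<epsilon> / 2"
    using contF \<open>x \<in> X\<close> \<open>x \<in> V\<close> \<open>\<epsilon> > 0\<close> unfolding continuous_on_iff by (metis IntI half_gt_zero)
  \<comment> \<open>Each of the three approximation steps moves points and normals by at most \<open>e\<close>.\<close>
  define e where "e = min (\<epsilon> / 4) (min (\<omega> / 2) (R / 4))"
  have "e > 0" using \<open>\<epsilon> > 0\<close> \<open>\<omega> > 0\<close> \<open>R > 0\<close> by (simp add: e_def)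
  have e: "4 * e \<le> \<epsilon>" "2 * e \<le> \<omega>" "4 * e \<le> R" by (auto simp: e_def)
  obtain x1 u1 v1 q1 where reg1: "(v1, q1) \<in> regular_normal_cone ?H (x1, u1)"
    and "dist (x1, u1) (x, u) < e" and "dist (v1, q1) (v, q) < e"
    using normal \<open>e > 0\<close> unfolding normal_cone_iff_approximable by (metis prod.exhaust)
  then have 1: "norm (x1 - x) < e" "norm (u1 - u) < e" "norm (v1 - v) < e" "norm (q1 - q) < e"
    using dist_fst_le[of "(x1, u1)" "(x, u)"] dist_snd_le[of "(x1, u1)" "(x, u)"]
      dist_fst_le[of "(v1, q1)" "(v, q)"] dist_snd_le[of "(v1, q1)" "(v, q)"]
    by (simp_all add: dist_norm)
  have mem1: "(x1, u1) \<in> ?H"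
    using reg1 by (simp add: regular_normal_cone_iff)
  have cl: "closed (?H \<inter> cball (x1, u1) (R / 2))"
  proof -
    have "X \<inter> cball x R \<subseteq> X \<inter> V" using R by auto
    then have "closed (?H \<inter> cball x R \<times> UNIV)"
      using \<open>closed X\<close> clS
      by (intro closed_gph_comp_over closed_Int closed_cball continuous_on_subset[OF contF]) auto
    then have "closed ((?H \<inter> cball x R \<times> UNIV) \<inter> cball (x1, u1) (R / 2))"
      using closed_Int closed_cball by blast
    moreover have "cball (x1, u1) (R / 2) \<subseteq> cball x R \<times> UNIV"
    proof
      fix p assume p: "p \<in> cball (x1, u1) (R / 2)"
      have "dist x1 (fst p) \<le> dist (x1, u1) p"
        using dist_fst_le[of "(x1, u1)" p] by simp
      then have "dist x (fst p) \<le> R"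
        using p 1(1) e \<open>e > 0\<close> dist_triangle[of x "fst p" x1] by (simp add: dist_norm norm_minus_commute)
      then show "p \<in> cball x R \<times> UNIV" by (simp add: mem_Times_iff)
    qed
    ultimately show ?thesis
      by (metis (no_types, lifting) Int_absorb1 Int_assoc)
  qed
  have "e / 2 > 0" using \<open>e > 0\<close> by simp
  then obtain \<eta> where "\<eta> > 0"
    and \<eta>: "\<And>p. p \<in> ?H \<Longrightarrow> norm (p - (x1, u1)) < \<eta> \<Longrightarrow>
      (v1, q1) \<bullet> (p - (x1, u1)) \<le> e / 2 * norm (p - (x1, u1))"
    using reg1 unfolding regular_normal_cone_iff by blast
  have "R / 2 > 0" "0 \<le> e / 2" using \<open>R > 0\<close> \<open>e > 0\<close> by auto
  obtain p2 a2 \<sigma> where "p2 \<in> ?H" and p2: "norm (p2 - (x1, u1)) < e"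
    and a2: "norm (a2 - (v1, q1)) \<le> 2 * (e / 2)"
    and quad: "\<And>p. p \<in> ?H \<inter> cball (x1, u1) (R / 2) \<Longrightarrow> a2 \<bullet> (p - p2) \<le> \<sigma> * (norm (p - p2))\<^sup>2"
    using proximal_normal_near_almost_normal[OF mem1 \<open>R / 2 > 0\<close> cl \<open>0 \<le> e / 2\<close> \<open>e > 0\<close> \<open>\<eta> > 0\<close> \<eta>]
    by metis
  obtain x2 u2 v2 q2 where eqs: "p2 = (x2, u2)" "a2 = (v2, q2)" by (metis prod.exhaust)
  have mem2: "x2 \<in> X" "u2 \<in> S\<^sub>0 (F x2)"
    using \<open>p2 \<in> ?H\<close> by (auto simp: eqs gph_restr_comp_single_valued)
  have 2: "norm (x2 - x1) < e" "norm (u2 - u1) < e" "norm (v2 - v1) \<le> e" "norm (q2 - q1) \<le> e"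
    using p2 a2 norm_fst_le[of "x2 - x1" "u2 - u1"] norm_snd_le[of "u2 - u1" "x2 - x1"]
      norm_fst_le[of "v2 - v1" "q2 - q1"] norm_snd_le[of "q2 - q1" "v2 - v1"]
    by (simp_all add: eqs)
  have 12: "norm (x2 - x) < 2 * e"
    using norm_triangle_ineq[of "x2 - x1" "x1 - x"] 1 2 by simp
  have contF2: "continuous_on (X \<inter> cball x2 e) F"
  proof (rule continuous_on_subset[OF contF], intro Int_mono order_refl subsetI)
    fix y assume "y \<in> cball x2 e"
    then have "norm (y - x) \<le> R"
      using norm_triangle_ineq[of "y - x2" "x2 - x"] 12 e \<open>e > 0\<close>
      by (simp add: dist_norm norm_minus_commute)
    then show "y \<in> V" using R by (auto simp: dist_norm norm_minus_commute)
  qed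
  define r where "r = e / 2"
  have r: "r > 0" "2 * r = e" using \<open>e > 0\<close> by (auto simp: r_def)
  have quad2: "v2 \<bullet> (y - x2) + q2 \<bullet> (s - u2) \<le> \<sigma> * ((norm (y - x2))\<^sup>2 + (norm (s - u2))\<^sup>2)"
    if "y \<in> X" "s \<in> S\<^sub>0 (F y)" "norm (y - x2) \<le> r" "norm (s - u2) \<le> r" for y s
  proof -
    have "norm ((y, s) - (x2, u2)) \<le> e"
      using norm_Pair_le[of "y - x2" "s - u2"] that r by simp
    then have "norm ((y, s) - (x1, u1)) \<le> R / 2"
      using norm_triangle_ineq[of "(y, s) - (x2, u2)" "(x2, u2) - (x1, u1)"] p2 e
      unfolding eqs by simp
    then have "(y, s) \<in> ?H \<inter> cball (x1, u1) (R / 2)"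
      using that unfolding gph_restr_comp_single_valued mem_cball dist_norm
      by (metis (mono_tags, lifting) IntI case_prodI mem_Collect_eq mem_cball dist_norm norm_minus_commute)
    from quad[OF this] show ?thesis
      by (simp only: eqs diff_Pair inner_Pair norm_Pair_squared)
  qed
  have contF3: "continuous_on (X \<inter> cball x2 r) F"
    by (rule continuous_on_subset[OF contF2]) (use r in auto)
  obtain y w s v' z q'
    where res: "(v', - z) \<in> regular_normal_cone (gph (restr (single_valued_map F) X)) (y, F y)"
      "(z, q') \<in> regular_normal_cone (gph S\<^sub>0) (w, s)"
      and 3: "norm (y - x2) < e" "norm (w - F x2) < e" "norm (s - u2) < e"
      "norm (v' - v2) < e" "norm (q' - q2) < e"
    by (rule proximal_chain_rule[OF \<open>closed X\<close> clS r(1) contF3 mem2 quad2 \<open>e > 0\<close>]) blast+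
  have "norm (F x2 - F x) < \<epsilon> / 2"
    using \<omega>[of x2] mem2 12 e R \<open>e > 0\<close> by (auto simp: dist_norm subset_iff norm_minus_commute)
  then have "norm (w - F x) < \<epsilon>"
    using norm_triangle_ineq[of "w - F x2" "F x2 - F x"] 3(2) e \<open>e > 0\<close> by simp
  moreover have "norm (y - x) < \<epsilon>" "norm (s - u) < \<epsilon>" "norm (v' - v) < \<epsilon>" "norm (q' - q) < \<epsilon>"
  proof -
    have tri: "norm (d - a) < \<epsilon>" if "norm (b - a) < e" "norm (c - b) \<le> e" "norm (d - c) < e"
      for a b c d :: "'z::real_normed_vector"
      using norm_triangle_ineq[of "d - c" "c - b"] norm_triangle_ineq[of "d - b" "b - a"] that e \<open>e > 0\<close>
      by simp
    show "norm (y - x) < \<epsilon>" "norm (s - u) < \<epsilon>" "norm (v' - v) < \<epsilon>" "norm (q' - q) < \<epsilon>"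
      using tri[of x1 x x2 y] tri[of u1 u u2 s] tri[of v1 v v2 v'] tri[of q1 q q2 q'] 1 2 3 by auto
  qed
  ultimately show thesis
    using that res by blast
qed

text \<open>
  The pairs of \<open>z k / (1 + norm (z k))\<close> and \<open>1 / (1 + norm (z k))\<close> lie in a compact set. The limit of the second
  component along a subsequence decides the case: if it is positive, the \<open>z k\<close> converge along the
  subsequence; if it is zero, they are unbounded and the rescaled vectors tend to a unit vector.
\<close>
lemma subsequence_converges_or_direction:
  fixes z :: "nat \<Rightarrow> 'a::euclidean_space"
  obtains (converges) h l where "strict_mono (h :: nat \<Rightarrow> nat)" "(\<lambda>k. z (h k)) \<longlonglongrightarrow> l"
  | (direction) h c l where "strict_mono (h :: nat \<Rightarrow> nat)" "\<And>k. c k > 0" "c \<longlonglongrightarrow> (0::real)"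
      "(\<lambda>k. c k *\<^sub>R z (h k)) \<longlonglongrightarrow> l" "norm l = 1"
proof -
  define c where "c k = inverse (1 + norm (z k))" for k
  have c: "c k > 0" "c k \<le> 1" "c k * norm (z k) = 1 - c k" for k
  proof -
    have "1 + norm (z k) > 0" using norm_ge_zero[of "z k"] by linarith
    then show "c k > 0" "c k \<le> 1" "c k * norm (z k) = 1 - c k"
      by (simp_all add: c_def field_simps)
  qed
  define f where "f k = (c k *\<^sub>R z k, c k)" for k
  have fK: "f k \<in> cball 0 1 \<times> cball 0 1" for k
  proof -
    have "norm (c k *\<^sub>R z k) \<le> 1" "norm (c k) \<le> 1" using c[of k] by simp_all
    then show ?thesis by (simp add: f_def)
  qed
  have "compact (cball (0::'a) 1 \<times> cball (0::real) 1)"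
    by (intro compact_Times compact_cball)
  then obtain l h where h: "strict_mono (h :: nat \<Rightarrow> nat)" and lim: "(f \<circ> h) \<longlonglongrightarrow> l"
    using fK unfolding compact_def by blast
  have lim1: "(\<lambda>k. c (h k) *\<^sub>R z (h k)) \<longlonglongrightarrow> fst l" and lim2: "(\<lambda>k. c (h k)) \<longlonglongrightarrow> snd l"
    using tendsto_fst[OF lim] tendsto_snd[OF lim] by (simp_all add: o_def f_def)
  show thesis
  proof (cases "snd l = 0")
    case True
    have "(\<lambda>k. norm (c (h k) *\<^sub>R z (h k))) \<longlonglongrightarrow> norm (fst l)"
      by (intro tendsto_intros lim1)
    moreover have "norm (c (h k) *\<^sub>R z (h k)) = 1 - c (h k)" for k
      using c[of "h k"] by simp
    moreover have "(\<lambda>k. 1 - c (h k)) \<longlonglongrightarrow> 1 - snd l"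
      by (intro tendsto_intros lim2)
    ultimately have "norm (fst l) = 1"
      using True LIMSEQ_unique by fastforce
    then show thesis
      using direction[OF h, of "\<lambda>k. c (h k)" "fst l"] c lim1 lim2 True by simp
  next
    case False
    have "(\<lambda>k. inverse (c (h k)) *\<^sub>R (c (h k) *\<^sub>R z (h k))) \<longlonglongrightarrow> inverse (snd l) *\<^sub>R fst l"
      by (intro tendsto_intros lim1 lim2 False)
    moreover have "inverse (c (h k)) *\<^sub>R (c (h k) *\<^sub>R z (h k)) = z (h k)" for k
      using c(1)[of "h k"] by simp
    ultimately show thesis
      using converges[OF h] by simp
  qed
qed

text \<open>
  If the multipliers of the fuzzy rule have a bounded subsequence, a limit of them is the desired \<open>z\<close>.
  Otherwise the normals are rescaled so that the multipliers have norm close to 1; the components \<open>v'\<close>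
  and \<open>q'\<close> then vanish in the limit, and the limit direction contradicts the qualification condition.
\<close>
lemma normal_cone_chain_rule:
  fixes F :: "'a::euclidean_space \<Rightarrow> 'b::euclidean_space"
    and S\<^sub>0 :: "('b, 'c::euclidean_space) setmap"
  assumes "closed X" and clS: "closed (gph S\<^sub>0)"
    and "open V" and "x \<in> V" and contF: "continuous_on (X \<inter> V) F"
    and qualification: "\<And>z. (z, 0) \<in> normal_cone (gph S\<^sub>0) (F x, u) \<Longrightarrow>
      (0, - z) \<in> normal_cone (gph (restr (single_valued_map F) X)) (x, F x) \<Longrightarrow> z = 0"
    and normal: "(v, q) \<in> normal_cone (gph (restr (comp_map S\<^sub>0 (single_valued_map F)) X)) (x, u)"
  obtains z where "(z, q) \<in> normal_cone (gph S\<^sub>0) (F x, u)"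
    and "(v, - z) \<in> normal_cone (gph (restr (single_valued_map F) X)) (x, F x)"
proof -
  let ?G = "gph (restr (single_valued_map F) X)"
  have "x \<in> X" "u \<in> S\<^sub>0 (F x)"
    using normal by (auto simp: normal_cone_def gph_restr_comp_single_valued)
  then have mem: "(x, F x) \<in> ?G" "(F x, u) \<in> gph S\<^sub>0"
    by (simp_all add: gph_restr_single_valued mem_gph_iff)
  have "\<exists>y w s v' z q'. (v', - z) \<in> regular_normal_cone ?G (y, F y) \<and>
      (z, q') \<in> regular_normal_cone (gph S\<^sub>0) (w, s) \<and>
      norm (y - x) < inverse (real (Suc k)) \<and> norm (w - F x) < inverse (real (Suc k)) \<and>
      norm (s - u) < inverse (real (Suc k)) \<and> norm (v' - v) < inverse (real (Suc k)) \<and>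
      norm (q' - q) < inverse (real (Suc k))" for k
    by (rule fuzzy_chain_rule[OF assms(1-5) normal, of "inverse (real (Suc k))"]) (simp, blast)
  then obtain y w s v' z q' where G: "\<And>k. (v' k, - z k) \<in> regular_normal_cone ?G (y k, F (y k))"
    and S: "\<And>k. (z k, q' k) \<in> regular_normal_cone (gph S\<^sub>0) (w k, s k)"
    and d: "\<And>k. norm (y k - x) < inverse (real (Suc k))" "\<And>k. norm (w k - F x) < inverse (real (Suc k))"
      "\<And>k. norm (s k - u) < inverse (real (Suc k))" "\<And>k. norm (v' k - v) < inverse (real (Suc k))"
      "\<And>k. norm (q' k - q) < inverse (real (Suc k))"
    by metis
  have y: "y \<longlonglongrightarrow> x" and w: "w \<longlonglongrightarrow> F x" and s: "s \<longlonglongrightarrow> u" and v': "v' \<longlonglongrightarrow> v" and q': "q' \<longlonglongrightarrow> q"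
    using d by (auto intro!: LIMSEQ_if_norm_less_inverse)
  have yX: "y k \<in> X" for k
    using G[of k] by (simp add: regular_normal_cone_iff gph_restr_single_valued)
  have "\<forall>\<^sub>F k in sequentially. y k \<in> X \<inter> V"
    using topological_tendstoD[OF y \<open>open V\<close> \<open>x \<in> V\<close>] by (simp add: yX)
  then have Fy: "(\<lambda>k. F (y k)) \<longlonglongrightarrow> F x"
    using \<open>x \<in> X\<close> \<open>x \<in> V\<close> by (intro continuous_on_tendsto_compose[OF contF y]) auto
  note sub = LIMSEQ_subseq_LIMSEQ[unfolded o_def]
  have G': "(v' k, - z k) \<in> normal_cone ?G (y k, F (y k))"
    and S': "(z k, q' k) \<in> normal_cone (gph S\<^sub>0) (w k, s k)" for k
    using G S regular_normal_cone_subset_normal_cone by blast+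
  show thesis
  proof (cases rule: subsequence_converges_or_direction[of z])
    case (converges h l)
    show thesis
    proof
      show "(l, q) \<in> normal_cone (gph S\<^sub>0) (F x, u)"
        using S' by (rule normal_cone_limit[OF mem(2) tendsto_Pair tendsto_Pair, rotated 4])
          (rule sub[OF w converges(1)] sub[OF s converges(1)] sub[OF q' converges(1)] converges(2))+
      show "(v, - l) \<in> normal_cone ?G (x, F x)"
        using G' by (rule normal_cone_limit[OF mem(1) tendsto_Pair tendsto_Pair, rotated 4])
          (rule sub[OF y converges(1)] sub[OF Fy converges(1)] sub[OF v' converges(1)]
            tendsto_minus[OF converges(2)])+
    qed
  next
    case (direction h c l)
    have "(\<lambda>k. c k *\<^sub>R q' (h k)) \<longlonglongrightarrow> 0 *\<^sub>R q" "(\<lambda>k. c k *\<^sub>R v' (h k)) \<longlonglongrightarrow> 0 *\<^sub>R v"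
      by (intro tendsto_scaleR direction(3) sub[OF q' direction(1)] sub[OF v' direction(1)])+
    then have c0: "(\<lambda>k. c k *\<^sub>R q' (h k)) \<longlonglongrightarrow> 0" "(\<lambda>k. c k *\<^sub>R v' (h k)) \<longlonglongrightarrow> 0" by simp_all
    have "(c k *\<^sub>R z (h k), c k *\<^sub>R q' (h k)) \<in> normal_cone (gph S\<^sub>0) (w (h k), s (h k))" for k
      using normal_cone_scale[OF S' direction(2)] by simp
    then have "(l, 0) \<in> normal_cone (gph S\<^sub>0) (F x, u)"
      by (rule normal_cone_limit[OF mem(2) tendsto_Pair tendsto_Pair, rotated 4])
        (rule sub[OF w direction(1)] sub[OF s direction(1)] c0 direction(4))+
    moreover have "(c k *\<^sub>R v' (h k), - (c k *\<^sub>R z (h k))) \<in> normal_cone ?G (y (h k), F (y (h k)))" for k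
      using normal_cone_scale[OF G' direction(2)] by simp
    then have "(0, - l) \<in> normal_cone ?G (x, F x)"
      by (rule normal_cone_limit[OF mem(1) tendsto_Pair tendsto_Pair, rotated 4])
        (rule sub[OF y direction(1)] sub[OF Fy direction(1)] c0 tendsto_minus[OF direction(4)])+
    ultimately have "l = 0" by (rule qualification)
    then show thesis using direction by simp
  qed
qed

section \<open>The projectional chain rule as an inclusion\<close>

lemma proj_set_iff:
  "y \<in> proj_set C x \<longleftrightarrow> y \<in> C \<and> (\<forall>z\<in>C. norm (y - x) \<le> norm (z - x))"
proof
  assume "y \<in> proj_set C x"
  then show "y \<in> C \<and> (\<forall>z\<in>C. norm (y - x) \<le> norm (z - x))"
    unfolding proj_set_def using infdist_le[of _ C x] by (auto simp: dist_norm norm_minus_commute)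
next
  assume y: "y \<in> C \<and> (\<forall>z\<in>C. norm (y - x) \<le> norm (z - x))"
  have "norm (y - x) \<le> dist x z" if "z \<in> C" for z
    using y that by (simp add: dist_norm norm_minus_commute[of x z])
  moreover have "C \<noteq> {}" using y by blast
  ultimately have "norm (y - x) \<le> infdist x C"
    by (simp add: infdist_notempty cINF_greatest)
  moreover have "infdist x C \<le> norm (y - x)"
    using y infdist_le[of y C x] by (simp add: dist_norm norm_minus_commute)
  ultimately show "y \<in> proj_set C x"
    using y by (simp add: proj_set_def)
qed

lemma proj_set_Times_UNIV_iff:
  "(a, b) \<in> proj_set (T \<times> UNIV) (v, w) \<longleftrightarrow> a \<in> proj_set T v \<and> b = w"
proof
  assume R: "(a, b) \<in> proj_set (T \<times> UNIV) (v, w)"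
  then have "a \<in> T" and min: "norm ((a, b) - (v, w)) \<le> norm ((z, s) - (v, w))" if "z \<in> T" for z s
    using that by (auto simp: proj_set_iff)
  have "a \<in> T" using R by (auto simp: proj_set_iff)
  have "(norm ((a, b) - (v, w)))\<^sup>2 \<le> (norm ((a, w) - (v, w)))\<^sup>2"
    using min[OF \<open>a \<in> T\<close>, of w] by (intro power_mono) auto
  then have "b = w"
    by (simp add: norm_Pair_squared)
  then show "a \<in> proj_set T v \<and> b = w"
    using min[of _ w] \<open>a \<in> T\<close> by (simp add: proj_set_iff norm_Pair)
next
  assume "a \<in> proj_set T v \<and> b = w"
  then have "a \<in> T" "b = w" and min: "\<And>z. z \<in> T \<Longrightarrow> norm (a - v) \<le> norm (z - v)"
    by (auto simp: proj_set_iff)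
  have "norm ((a, w) - (v, w)) \<le> norm ((z, s) - (v, w))" if "z \<in> T" for z s
    using order_trans[OF min[OF that] norm_fst_le[of "z - v" "s - w"]] by simp
  then show "(a, b) \<in> proj_set (T \<times> UNIV) (v, w)"
    using \<open>a \<in> T\<close> \<open>b = w\<close> by (auto simp: proj_set_iff)
qed

lemma tangent_cone_iff:
  "w \<in> tangent_cone C x \<longleftrightarrow> x \<in> C \<and>
    (\<exists>t ys. (\<forall>k::nat. t k > 0 \<and> ys k \<in> C) \<and> t \<longlonglongrightarrow> 0 \<and> (\<lambda>k. (ys k - x) /\<^sub>R t k) \<longlonglongrightarrow> w)"
    (is "_ \<longleftrightarrow> x \<in> C \<and> ?R")
proof (intro iffI conjI)
  assume w: "w \<in> tangent_cone C x"
  then show "x \<in> C" by (simp add: tangent_cone_def)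
  obtain t ws where t: "filterlim t (at_right (0::real)) sequentially"
    and "\<forall>k::nat. ws k \<in> (\<lambda>y. (y - x) /\<^sub>R t k) ` C" and ws: "ws \<longlonglongrightarrow> w"
    using w unfolding tangent_cone_def outer_limit_def by blast
  then have "\<forall>k. \<exists>y. y \<in> C \<and> ws k = (y - x) /\<^sub>R t k" by blast
  then obtain ys where ys: "\<And>k. ys k \<in> C \<and> ws k = (ys k - x) /\<^sub>R t k" by metis
  have "t \<longlonglongrightarrow> 0" and "\<forall>\<^sub>F k in sequentially. t k > 0"
    using t unfolding filterlim_at by (auto elim: eventually_mono)
  then obtain N where N: "\<And>k. k \<ge> N \<Longrightarrow> t k > 0"
    unfolding eventually_sequentially by blast
  have "(\<lambda>k. (ys (k + N) - x) /\<^sub>R t (k + N)) \<longlonglongrightarrow> w"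
    using LIMSEQ_ignore_initial_segment[OF ws, of N] ys by simp
  moreover have "(\<lambda>k. t (k + N)) \<longlonglongrightarrow> 0"
    using \<open>t \<longlonglongrightarrow> 0\<close> by (rule LIMSEQ_ignore_initial_segment)
  moreover have "\<forall>k. t (k + N) > 0 \<and> ys (k + N) \<in> C"
    using N ys by simp
  ultimately show ?R
    by (intro exI[of _ "\<lambda>k. t (k + N)"] exI[of _ "\<lambda>k. ys (k + N)"]) simp
next
  assume "x \<in> C \<and> ?R"
  then obtain t ys where "x \<in> C" and R: "\<And>k::nat. t k > 0 \<and> ys k \<in> C" "t \<longlonglongrightarrow> 0"
    "(\<lambda>k. (ys k - x) /\<^sub>R t k) \<longlonglongrightarrow> w" by blast
  have "filterlim t (at_right 0) sequentially"
    using R by (auto simp: filterlim_at less_imp_neq[symmetric])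
  then show "w \<in> tangent_cone C x"
    using R \<open>x \<in> C\<close> unfolding tangent_cone_def outer_limit_def
    by (auto intro!: exI[of _ t] exI[of _ "\<lambda>k. (ys k - x) /\<^sub>R t k"])
qed

lemma zero_in_tangent_cone:
  assumes "x \<in> C"
  shows "0 \<in> tangent_cone C x"
  unfolding tangent_cone_iff
  using assms LIMSEQ_inverse_real_of_nat
  by (auto intro!: exI[of _ "\<lambda>k. inverse (real (Suc k))"] exI[of _ "\<lambda>_. x"])

lemma tangent_cone_scale:
  assumes "w \<in> tangent_cone C x" and "c > 0"
  shows "c *\<^sub>R w \<in> tangent_cone C x"
proof -
  obtain t ys where "x \<in> C" and R: "\<And>k::nat. t k > 0 \<and> ys k \<in> C" "t \<longlonglongrightarrow> 0"
    "(\<lambda>k. (ys k - x) /\<^sub>R t k) \<longlonglongrightarrow> w"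
    using assms unfolding tangent_cone_iff by blast
  have "(\<lambda>k. inverse c * t k) \<longlonglongrightarrow> inverse c * 0"
    by (intro tendsto_intros R)
  moreover have "(\<lambda>k. c *\<^sub>R ((ys k - x) /\<^sub>R t k)) \<longlonglongrightarrow> c *\<^sub>R w"
    by (intro tendsto_intros R)
  moreover have "c *\<^sub>R ((ys k - x) /\<^sub>R t k) = (ys k - x) /\<^sub>R (inverse c * t k)" for k
    by (simp add: inverse_mult_distrib)
  ultimately show ?thesis
    unfolding tangent_cone_iff using R \<open>c > 0\<close> \<open>x \<in> C\<close>
    by (intro conjI exI[of _ "\<lambda>k. inverse c * t k"] exI[of _ ys]) auto
qed

lemma proj_tangent_cone_scale:
  assumes "a \<in> proj_set (tangent_cone C x) v" and "c > 0"
  shows "c *\<^sub>R a \<in> proj_set (tangent_cone C x) (c *\<^sub>R v)"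
  unfolding proj_set_iff
proof (intro conjI ballI)
  show "c *\<^sub>R a \<in> tangent_cone C x"
    using assms by (simp add: proj_set_iff tangent_cone_scale)
  fix z assume "z \<in> tangent_cone C x"
  then have "inverse c *\<^sub>R z \<in> tangent_cone C x"
    using \<open>c > 0\<close> by (simp add: tangent_cone_scale)
  then have "norm (a - v) \<le> norm (inverse c *\<^sub>R z - v)"
    using assms by (simp add: proj_set_iff)
  then have "c * norm (a - v) \<le> c * norm (inverse c *\<^sub>R z - v)"
    using \<open>c > 0\<close> by simp
  also have "c * norm (inverse c *\<^sub>R z - v) = norm (c *\<^sub>R (inverse c *\<^sub>R z - v))"
    using \<open>c > 0\<close> by simp
  also have "c *\<^sub>R (inverse c *\<^sub>R z - v) = z - c *\<^sub>R v"
    using \<open>c > 0\<close> by (simp add: scaleR_diff_right)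
  also have "c * norm (a - v) = norm (c *\<^sub>R a - c *\<^sub>R v)"
    using \<open>c > 0\<close> by (simp flip: scaleR_diff_right)
  finally show "norm (c *\<^sub>R a - c *\<^sub>R v) \<le> norm (z - c *\<^sub>R v)" .
qed

text \<open>
  The projection on \<open>tangent_cone X y \<times> UNIV\<close> acts on the first component only, and the points of the
  sequence lie in the graph because normal cones at other points are empty.
\<close>
lemma proj_coderivative_iff:
  fixes S :: "('a::euclidean_space, 'b::euclidean_space) setmap"
  shows "t' \<in> proj_coderivative X S x u u' \<longleftrightarrow>
    (\<exists>ys ws vs ts us. (\<forall>k::nat. (vs k, - us k) \<in> normal_cone (gph (restr S X)) (ys k, ws k) \<and>
        ts k \<in> proj_set (tangent_cone X (ys k)) (vs k)) \<and>
      ys \<longlonglongrightarrow> x \<and> ws \<longlonglongrightarrow> u \<and> ts \<longlonglongrightarrow> t' \<and> us \<longlonglongrightarrow> u')" (is "_ \<longleftrightarrow> ?R")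
proof
  let ?N = "normal_cone (gph (restr S X))"
  assume "t' \<in> proj_coderivative X S x u u'"
  then obtain ps qs where ps: "filterlim ps (inf (nhds (x, u)) (principal (gph (restr S X)))) sequentially"
    and qs: "\<forall>k::nat. qs k \<in> (case ps k of (y, w) \<Rightarrow>
      \<Union>a \<in> ?N (y, w). proj_set (tangent_cone X y \<times> UNIV) a)"
    and lim: "qs \<longlonglongrightarrow> (t', - u')"
    unfolding proj_coderivative_def outer_limit_def by blast
  have "\<forall>k. \<exists>a. a \<in> ?N (ps k) \<and> qs k \<in> proj_set (tangent_cone X (fst (ps k)) \<times> UNIV) a"
    using qs by (simp add: case_prod_unfold Bex_def)
  then obtain as where as: "\<And>k. as k \<in> ?N (ps k)"
    "\<And>k. qs k \<in> proj_set (tangent_cone X (fst (ps k)) \<times> UNIV) (as k)"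
    by metis
  have "fst (qs k) \<in> proj_set (tangent_cone X (fst (ps k))) (fst (as k)) \<and> snd (qs k) = snd (as k)" for k
    using as(2)[of k] proj_set_Times_UNIV_iff[of "fst (qs k)" "snd (qs k)" _ "fst (as k)" "snd (as k)"]
    by simp
  moreover from this have "(fst (as k), - (- snd (qs k))) \<in> ?N (fst (ps k), snd (ps k))" for k
    using as(1)[of k] by simp
  moreover have "ps \<longlonglongrightarrow> (x, u)"
    using ps by (simp add: filterlim_inf)
  then have "(\<lambda>k. fst (ps k)) \<longlonglongrightarrow> x" "(\<lambda>k. snd (ps k)) \<longlonglongrightarrow> u"
    using tendsto_fst tendsto_snd by fastforce+
  moreover have "(\<lambda>k. fst (qs k)) \<longlonglongrightarrow> t'" "(\<lambda>k. - snd (qs k)) \<longlonglongrightarrow> u'"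
    using tendsto_fst[OF lim] tendsto_minus[OF tendsto_snd[OF lim]] by simp_all
  ultimately show ?R
    by (intro exI[of _ "\<lambda>k. fst (ps k)"] exI[of _ "\<lambda>k. snd (ps k)"] exI[of _ "\<lambda>k. fst (as k)"]
        exI[of _ "\<lambda>k. fst (qs k)"] exI[of _ "\<lambda>k. - snd (qs k)"]) blast
next
  let ?N = "normal_cone (gph (restr S X))"
  assume ?R
  then obtain ys ws vs ts us
    where N: "\<And>k::nat. (vs k, - us k) \<in> ?N (ys k, ws k)"
      and proj: "\<And>k. ts k \<in> proj_set (tangent_cone X (ys k)) (vs k)"
      and lim: "ys \<longlonglongrightarrow> x" "ws \<longlonglongrightarrow> u" "ts \<longlonglongrightarrow> t'" "us \<longlonglongrightarrow> u'"
    by blast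
  have "(ys k, ws k) \<in> gph (restr S X)" for k
    using N[of k] by (simp add: normal_cone_def)
  then have "filterlim (\<lambda>k. (ys k, ws k)) (inf (nhds (x, u)) (principal (gph (restr S X)))) sequentially"
    using lim by (auto simp: filterlim_inf filterlim_principal intro: tendsto_Pair)
  moreover have "(ts k, - us k) \<in> proj_set (tangent_cone X (ys k) \<times> UNIV) (vs k, - us k)" for k
    using proj by (simp add: proj_set_Times_UNIV_iff)
  moreover have "(\<lambda>k. (ts k, - us k)) \<longlonglongrightarrow> (t', - u')"
    by (intro tendsto_intros lim)
  ultimately show "t' \<in> proj_coderivative X S x u u'"
    unfolding proj_coderivative_def outer_limit_def mem_Collect_eq using N
    by (intro exI[of _ "\<lambda>k. (ys k, ws k)"] exI[of _ "\<lambda>k. (ts k, - us k)"] conjI allI) auto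
qed

text \<open>
  The qualification condition speaks of the base point and of projected normals, while the chain rule for
  limiting normals is applied at nearby points and needs a condition on unprojected ones. It holds there: \<open>0\<close>
  is its own projection on a tangent cone, so unit multipliers that violate it at points converging to
  \<open>(x, u)\<close> have a limit that violates the condition at \<open>(x, u)\<close>.
\<close>
lemma qualification_nearby:
  fixes F :: "'a::euclidean_space \<Rightarrow> 'b::euclidean_space"
    and S\<^sub>0 :: "('b, 'c::euclidean_space) setmap"
  assumes clS: "closed (gph S\<^sub>0)" and "open V" and "x \<in> V" and "x \<in> X" and "u \<in> S\<^sub>0 (F x)"
    and contF: "continuous_on (X \<inter> V) F"
    and qualification: "\<And>z. (z, 0) \<in> normal_cone (gph S\<^sub>0) (F x, u) \<Longrightarrow>
      0 \<in> proj_coderivative X (single_valued_map F) x (F x) z \<Longrightarrow> z = 0"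
  obtains \<delta> where "\<delta> > 0"
    "\<And>y s z. norm (y - x) < \<delta> \<Longrightarrow> norm (s - u) < \<delta> \<Longrightarrow> (z, 0) \<in> normal_cone (gph S\<^sub>0) (F y, s) \<Longrightarrow>
      (0, - z) \<in> normal_cone (gph (restr (single_valued_map F) X)) (y, F y) \<Longrightarrow> z = 0"
proof (rule ccontr)
  let ?G = "gph (restr (single_valued_map F) X)"
  let ?bad = "\<lambda>\<delta> y s z. norm (y - x) < \<delta> \<and> norm (s - u) < \<delta> \<and>
    (z, 0) \<in> normal_cone (gph S\<^sub>0) (F y, s) \<and> (0, - z) \<in> normal_cone ?G (y, F y) \<and> z \<noteq> 0"
  assume "\<not> thesis"
  then have "\<And>\<delta>. \<delta> > 0 \<Longrightarrow> \<exists>y s z. ?bad \<delta> y s z"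
    using that by blast
  then have "\<forall>k. \<exists>y s z. ?bad (inverse (real (Suc k))) y s z"
    by simp
  then obtain y s z where bad: "\<And>k. ?bad (inverse (real (Suc k))) (y k) (s k) (z k)"
    by metis
  have y: "y \<longlonglongrightarrow> x" and s: "s \<longlonglongrightarrow> u"
    using bad by (auto intro!: LIMSEQ_if_norm_less_inverse)
  have yX: "y k \<in> X" for k
    using bad[of k] by (auto simp: normal_cone_def gph_restr_single_valued)
  have "\<forall>\<^sub>F k in sequentially. y k \<in> X \<inter> V"
    using topological_tendstoD[OF y \<open>open V\<close> \<open>x \<in> V\<close>] by (simp add: yX)
  then have Fy: "(\<lambda>k. F (y k)) \<longlonglongrightarrow> F x"
    using \<open>x \<in> X\<close> \<open>x \<in> V\<close> by (intro continuous_on_tendsto_compose[OF contF y]) auto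
  define e where "e k = z k /\<^sub>R norm (z k)" for k
  have nz: "inverse (norm (z k)) > 0" for k using bad[of k] by simp
  have e1: "(e k, 0) \<in> normal_cone (gph S\<^sub>0) (F (y k), s k)" for k
    using normal_cone_scale[OF _ nz[of k], of "(z k, 0)" "gph S\<^sub>0" "(F (y k), s k)"] bad[of k]
    by (simp add: e_def)
  have e2: "(0, - e k) \<in> normal_cone ?G (y k, F (y k))" for k
    using normal_cone_scale[OF _ nz[of k], of "(0, - z k)" ?G "(y k, F (y k))"] bad[of k]
    by (simp add: e_def)
  have "e k \<in> sphere 0 1" for k
    using bad[of k] by (simp add: e_def)
  then obtain l h where "l \<in> sphere 0 1" and h: "strict_mono (h :: nat \<Rightarrow> nat)" and "(e \<circ> h) \<longlonglongrightarrow> l"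
    using compact_sphere[of "0::'b" 1] unfolding compact_def by blast
  then have l: "(\<lambda>k. e (h k)) \<longlonglongrightarrow> l" by (simp add: o_def)
  note sub = LIMSEQ_subseq_LIMSEQ[unfolded o_def, OF _ h]
  have "(F x, u) \<in> gph S\<^sub>0" using \<open>u \<in> S\<^sub>0 (F x)\<close> by (simp add: mem_gph_iff)
  then have "(l, 0) \<in> normal_cone (gph S\<^sub>0) (F x, u)"
    by (rule normal_cone_limit[OF _ tendsto_Pair[OF sub[OF Fy] sub[OF s]] tendsto_Pair[OF l tendsto_const]])
      (rule e1)
  moreover have "0 \<in> proj_coderivative X (single_valued_map F) x (F x) l"
    unfolding proj_coderivative_iff
  proof (intro exI conjI allI)
    show "(0, - e (h k)) \<in> normal_cone ?G (y (h k), F (y (h k)))" for k by (rule e2)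
    show "0 \<in> proj_set (tangent_cone X (y (h k))) 0" for k
      using yX by (simp add: proj_set_iff zero_in_tangent_cone)
  qed (rule sub[OF y] sub[OF Fy] tendsto_const l)+
  ultimately have "l = 0" by (rule qualification)
  then show False using \<open>l \<in> sphere 0 1\<close> by simp
qed

text \<open>
  The chain rule for limiting normals has to be applied exactly at the points of the sequence that defines
  \<open>t'\<close>, since the tangent cones of \<open>X\<close> at nearby points, and hence the projections, need not be close.
  The resulting multipliers are bounded along a subsequence by the same rescaling as before: projections on a cone are
  positively homogeneous, so that rescaled projections \<open>ts\<close> tend to \<open>0\<close>.
\<close>
theorem proj_coderivative_chain_rule:
  fixes F :: "'a::euclidean_space \<Rightarrow> 'b::euclidean_space"
    and S\<^sub>0 :: "('b, 'c::euclidean_space) setmap"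
  assumes "closed X" and clS: "closed (gph S\<^sub>0)" and "open V" and "x \<in> V" and "x \<in> X"
    and "u \<in> S\<^sub>0 (F x)" and contF: "continuous_on (X \<inter> V) F"
    and qualification: "\<And>z. (z, 0) \<in> normal_cone (gph S\<^sub>0) (F x, u) \<Longrightarrow>
      0 \<in> proj_coderivative X (single_valued_map F) x (F x) z \<Longrightarrow> z = 0"
    and t': "t' \<in> proj_coderivative X (comp_map S\<^sub>0 (single_valued_map F)) x u u'"
  obtains z where "(z, - u') \<in> normal_cone (gph S\<^sub>0) (F x, u)"
    and "t' \<in> proj_coderivative X (single_valued_map F) x (F x) z"
proof -
  let ?G = "gph (restr (single_valued_map F) X)"
  let ?H = "gph (restr (comp_map S\<^sub>0 (single_valued_map F)) X)"
  obtain \<delta> where "\<delta> > 0"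
    and nearby: "\<And>y s z. norm (y - x) < \<delta> \<Longrightarrow> norm (s - u) < \<delta> \<Longrightarrow>
      (z, 0) \<in> normal_cone (gph S\<^sub>0) (F y, s) \<Longrightarrow> (0, - z) \<in> normal_cone ?G (y, F y) \<Longrightarrow> z = 0"
    using qualification_nearby[where F = F and S\<^sub>0 = S\<^sub>0 and X = X, OF clS \<open>open V\<close> \<open>x \<in> V\<close> \<open>x \<in> X\<close>
        \<open>u \<in> S\<^sub>0 (F x)\<close> contF qualification] by blast
  obtain ys' ws' vs' ts' us'
    where N': "\<And>k::nat. (vs' k, - us' k) \<in> normal_cone ?H (ys' k, ws' k)"
      and proj': "\<And>k. ts' k \<in> proj_set (tangent_cone X (ys' k)) (vs' k)"
      and lim': "ys' \<longlonglongrightarrow> x" "ws' \<longlonglongrightarrow> u" "ts' \<longlonglongrightarrow> t'" "us' \<longlonglongrightarrow> u'"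
    using t' unfolding proj_coderivative_iff by blast
  have "\<forall>\<^sub>F k in sequentially. ys' k \<in> V \<and> dist (ys' k) x < \<delta> \<and> dist (ws' k) u < \<delta>"
    using lim' \<open>open V\<close> \<open>x \<in> V\<close> \<open>\<delta> > 0\<close>
    by (intro eventually_conj topological_tendstoD tendstoD)
  then obtain n where n: "\<And>k. k \<ge> n \<Longrightarrow> ys' k \<in> V \<and> dist (ys' k) x < \<delta> \<and> dist (ws' k) u < \<delta>"
    unfolding eventually_sequentially by blast
  define ys ws vs ts us where "ys k = ys' (k + n)" and "ws k = ws' (k + n)" and "vs k = vs' (k + n)"
    and "ts k = ts' (k + n)" and "us k = us' (k + n)" for k
  note defs = ys_def ws_def vs_def ts_def us_def
  have N: "(vs k, - us k) \<in> normal_cone ?H (ys k, ws k)"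
    and proj: "ts k \<in> proj_set (tangent_cone X (ys k)) (vs k)"
    and near: "norm (ys k - x) < \<delta>" "norm (ws k - u) < \<delta>" and yV: "ys k \<in> V" for k
    using N'[of "k + n"] proj'[of "k + n"] n[of "k + n"] by (simp_all add: defs dist_norm)
  have y: "ys \<longlonglongrightarrow> x" and w: "ws \<longlonglongrightarrow> u" and t: "ts \<longlonglongrightarrow> t'" and u: "us \<longlonglongrightarrow> u'"
    unfolding defs using lim' by (simp_all add: LIMSEQ_ignore_initial_segment)
  have yX: "ys k \<in> X" for k
    using N[of k] by (auto simp: normal_cone_def gph_restr_comp_single_valued)
  have Fy: "(\<lambda>k. F (ys k)) \<longlonglongrightarrow> F x"
    using \<open>x \<in> X\<close> \<open>x \<in> V\<close> yX yV by (intro continuous_on_tendsto_compose[OF contF y]) auto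
  have "\<exists>z. (z, - us k) \<in> normal_cone (gph S\<^sub>0) (F (ys k), ws k) \<and>
      (vs k, - z) \<in> normal_cone ?G (ys k, F (ys k))" for k
    by (rule normal_cone_chain_rule[OF \<open>closed X\<close> clS \<open>open V\<close> yV contF nearby[OF near] N]) blast+
  then obtain z where z1: "\<And>k. (z k, - us k) \<in> normal_cone (gph S\<^sub>0) (F (ys k), ws k)"
    and z2: "\<And>k. (vs k, - z k) \<in> normal_cone ?G (ys k, F (ys k))"
    by metis
  have mem: "(F x, u) \<in> gph S\<^sub>0" using \<open>u \<in> S\<^sub>0 (F x)\<close> by (simp add: mem_gph_iff)
  show thesis
  proof (cases rule: subsequence_converges_or_direction[of z])
    case (converges h l)
    note sub = LIMSEQ_subseq_LIMSEQ[unfolded o_def, OF _ converges(1)]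
    have "(l, - u') \<in> normal_cone (gph S\<^sub>0) (F x, u)"
      by (rule normal_cone_limit[OF mem tendsto_Pair[OF sub[OF Fy] sub[OF w]]
            tendsto_Pair[OF converges(2) tendsto_minus[OF sub[OF u]]]]) (rule z1)
    moreover have "t' \<in> proj_coderivative X (single_valued_map F) x (F x) l"
      unfolding proj_coderivative_iff
    proof (intro exI conjI allI)
      show "(vs (h k), - z (h k)) \<in> normal_cone ?G (ys (h k), F (ys (h k)))" for k by (rule z2)
      show "ts (h k) \<in> proj_set (tangent_cone X (ys (h k))) (vs (h k))" for k by (rule proj)
    qed (rule sub[OF y] sub[OF Fy] sub[OF t] converges(2))+
    ultimately show thesis by (rule that)
  next
    case (direction h c l)
    note sub = LIMSEQ_subseq_LIMSEQ[unfolded o_def, OF _ direction(1)]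
    have "(\<lambda>k. c k *\<^sub>R us (h k)) \<longlonglongrightarrow> 0 *\<^sub>R u'" "(\<lambda>k. c k *\<^sub>R ts (h k)) \<longlonglongrightarrow> 0 *\<^sub>R t'"
      by (intro tendsto_scaleR direction(3) sub[OF u] sub[OF t])+
    then have c0: "(\<lambda>k. - (c k *\<^sub>R us (h k))) \<longlonglongrightarrow> 0" "(\<lambda>k. c k *\<^sub>R ts (h k)) \<longlonglongrightarrow> 0"
      using tendsto_minus by fastforce+
    have "(c k *\<^sub>R z (h k), - (c k *\<^sub>R us (h k))) \<in> normal_cone (gph S\<^sub>0) (F (ys (h k)), ws (h k))" for k
      using normal_cone_scale[OF z1 direction(2)] by simp
    then have "(l, 0) \<in> normal_cone (gph S\<^sub>0) (F x, u)"
      by (rule normal_cone_limit[OF mem tendsto_Pair[OF sub[OF Fy] sub[OF w]]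
            tendsto_Pair[OF direction(4) c0(1)]])
    moreover have "0 \<in> proj_coderivative X (single_valued_map F) x (F x) l"
      unfolding proj_coderivative_iff
    proof (intro exI conjI allI)
      show "(c k *\<^sub>R vs (h k), - (c k *\<^sub>R z (h k))) \<in> normal_cone ?G (ys (h k), F (ys (h k)))" for k
        using normal_cone_scale[OF z2 direction(2)] by simp
      show "c k *\<^sub>R ts (h k) \<in> proj_set (tangent_cone X (ys (h k))) (c k *\<^sub>R vs (h k))" for k
        by (rule proj_tangent_cone_scale[OF proj direction(2)])
    qed (rule sub[OF y] sub[OF Fy] c0(2) direction(4))+
    ultimately have "l = 0" by (rule qualification)
    then show thesis using direction by simp
  qed
qed

section \<open>Regularity of the composition\<close>

lemma regular_normal_near_almost_normal:
  fixes C :: "'a::euclidean_space set"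
  assumes "x \<in> C" and "r > 0" and "closed (C \<inter> cball x r)" and "\<epsilon> \<ge> 0" and "\<delta> > 0" and "\<eta> > 0"
    and "\<And>y. y \<in> C \<Longrightarrow> norm (y - x) < \<eta> \<Longrightarrow> v \<bullet> (y - x) \<le> \<epsilon> * norm (y - x)"
  obtains x' v' where "v' \<in> regular_normal_cone C x'" "norm (x' - x) < \<delta>" "norm (v' - v) \<le> 2 * \<epsilon>"
proof -
  have "min \<delta> r > 0" using \<open>\<delta> > 0\<close> \<open>r > 0\<close> by simp
  obtain x' v' \<sigma> where "x' \<in> C" and x': "norm (x' - x) < min \<delta> r" and v': "norm (v' - v) \<le> 2 * \<epsilon>"
    and quad: "\<And>y. y \<in> C \<inter> cball x r \<Longrightarrow> v' \<bullet> (y - x') \<le> \<sigma> * (norm (y - x'))\<^sup>2"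
    by (rule proximal_normal_near_almost_normal[OF assms(1-4) \<open>min \<delta> r > 0\<close> assms(6,7)]) blast+
  have "v' \<in> regular_normal_cone C x'"
  proof (rule regular_normal_if_quadratic_bound)
    show "r - norm (x' - x) > 0" using x' by simp
    fix y assume "y \<in> C" and "norm (y - x') < r - norm (x' - x)"
    then have "y \<in> C \<inter> cball x r"
      using norm_triangle_ineq[of "y - x'" "x' - x"] by (simp add: dist_norm norm_minus_commute)
    then show "v' \<bullet> (y - x') \<le> \<sigma> * (norm (y - x'))\<^sup>2" by (rule quad)
  qed fact
  then show thesis using that x' v' by simp
qed

lemma mem_epi_scalarization:
  "(y, \<alpha>) \<in> epi (scalarization z F X) \<longleftrightarrow> y \<in> X \<and> z \<bullet> F y \<le> \<alpha>"
  by (simp add: epi_def scalarization_def)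

lemma closed_epi_scalarization_over:
  fixes F :: "'a::metric_space \<Rightarrow> 'b::real_inner"
  assumes "closed (X \<inter> A)" and "continuous_on (X \<inter> A) F"
  shows "closed (epi (scalarization z F X) \<inter> A \<times> UNIV)"
proof -
  have "continuous_on ((X \<inter> A) \<times> UNIV) (\<lambda>p. F (fst p))"
    by (rule continuous_on_compose2[OF assms(2) continuous_on_fst[OF continuous_on_id]]) auto
  then have "continuous_on ((X \<inter> A) \<times> UNIV) (\<lambda>p. snd p - z \<bullet> F (fst p))"
    by (intro continuous_intros)
  then have "closed (((X \<inter> A) \<times> UNIV) \<inter> (\<lambda>p. snd p - z \<bullet> F (fst p)) -` {0..})"
    using assms by (intro continuous_closed_preimage closed_Times) auto
  also have "((X \<inter> A) \<times> UNIV) \<inter> (\<lambda>p. snd p - z \<bullet> F (fst p)) -` {0..}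
      = epi (scalarization z F X) \<inter> A \<times> UNIV"
    by (auto simp: mem_epi_scalarization)
  finally show ?thesis .
qed

text \<open>
  A regular normal \<open>(v1, z1')\<close> of the graph near \<open>(v, - z)\<close> makes \<open>v1 \<bullet> (y - x1) + z1' \<bullet> (F y - F x1)\<close> at most a
  small multiple of \<open>norm (y - x1)\<close>, because \<open>F\<close> is Lipschitz continuous on \<open>X\<close> near \<open>x\<close>. For the same reason \<open>z1'\<close> may
  be replaced by \<open>- z\<close> here, at the cost of \<open>norm (z1' + z) * L * norm (y - x1)\<close>. So \<open>(v1, - 1)\<close> is almost a normal of the
  epigraph, and true normals are nearby.
\<close>
lemma normal_cone_epi_scalarization:
  fixes F :: "'a::euclidean_space \<Rightarrow> 'b::euclidean_space"
  assumes "closed X" and "open V" and "x \<in> V" and lip: "L-lipschitz_on (X \<inter> V) F"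
    and normal: "(v, - z) \<in> normal_cone (gph (restr (single_valued_map F) X)) (x, F x)"
  shows "(v, - 1) \<in> normal_cone (epi (scalarization z F X)) (x, z \<bullet> F x)"
  unfolding normal_cone_iff_approximable
proof (intro conjI allI impI)
  let ?G = "gph (restr (single_valued_map F) X)" and ?E = "epi (scalarization z F X)"
  have "x \<in> X"
    using normal by (auto simp: normal_cone_def gph_restr_single_valued)
  then show "(x, z \<bullet> F x) \<in> ?E" by (simp add: mem_epi_scalarization)
  have "L \<ge> 0" using lip by (rule lipschitz_on_nonneg)
  have lipD: "norm (F a - F b) \<le> L * norm (a - b)" if "a \<in> X" "a \<in> V" "b \<in> X" "b \<in> V" for a b
    using lipschitz_onD[OF lip, of a b] that by (simp add: dist_norm)
  obtain R where "R > 0" and R: "cball x R \<subseteq> V"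
    using \<open>open V\<close> \<open>x \<in> V\<close> open_contains_cball by blast
  fix \<epsilon> :: real assume "\<epsilon> > 0"
  \<comment> \<open>\<open>e * M\<close> bounds all the errors below together.\<close>
  define M where "M = 4 + norm z + 4 * L"
  have "M > 0" using \<open>L \<ge> 0\<close> norm_ge_zero[of z] unfolding M_def by linarith
  define e where "e = min (R / 2) (\<epsilon> / M)"
  have "e > 0" using \<open>R > 0\<close> \<open>\<epsilon> > 0\<close> \<open>M > 0\<close> by (simp add: e_def)
  have "e \<le> R / 2" "e \<le> \<epsilon> / M" unfolding e_def by (rule min.cobounded1 min.cobounded2)+
  then have "e * M \<le> \<epsilon>" using \<open>M > 0\<close> by (simp add: pos_le_divide_eq)
  then have eM: "4 * e + e * norm z + 4 * (e * L) \<le> \<epsilon>" by (simp add: M_def algebra_simps)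
  obtain p1 v1 z1' where reg1: "(v1, z1') \<in> regular_normal_cone ?G p1"
    and d1: "dist p1 (x, F x) < e" "dist (v1, z1') (v, - z) < e"
    using normal \<open>e > 0\<close> unfolding normal_cone_iff_approximable by (metis prod.exhaust)
  have "p1 \<in> ?G" using reg1 by (simp add: regular_normal_cone_iff)
  then obtain x1 where "x1 \<in> X" and p1: "p1 = (x1, F x1)" by (auto simp: gph_restr_single_valued)
  have n1: "norm (x1 - x) < e" "norm (F x1 - F x) < e" "norm (v1 - v) < e" "norm (z1' + z) < e"
    using d1 dist_fst_le[of p1 "(x, F x)"] dist_snd_le[of p1 "(x, F x)"]
      dist_fst_le[of "(v1, z1')" "(v, - z)"] dist_snd_le[of "(v1, z1')" "(v, - z)"]
    by (simp_all add: dist_norm p1)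
  have ball1: "cball x1 (R / 2) \<subseteq> V"
  proof
    fix y assume "y \<in> cball x1 (R / 2)"
    then have "y \<in> cball x R"
      using n1(1) \<open>e \<le> R / 2\<close> norm_triangle_ineq[of "y - x1" "x1 - x"]
      by (simp add: dist_norm norm_minus_commute)
    then show "y \<in> V" using R by blast
  qed
  then have "x1 \<in> V" using \<open>R > 0\<close> by (meson centre_in_cball half_gt_zero less_imp_le subsetD)
  have "R / 2 > 0" using \<open>R > 0\<close> by simp
  let ?b = "(x1, z \<bullet> F x1)"
  have bE: "?b \<in> ?E" using \<open>x1 \<in> X\<close> by (simp add: mem_epi_scalarization)
  have cl: "closed (?E \<inter> cball ?b (R / 2))"
  proof -
    have "continuous_on (X \<inter> cball x1 (R / 2)) F"
      using ball1 by (intro continuous_on_subset[OF lipschitz_on_continuous_on[OF lip]]) auto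
    then have "closed (?E \<inter> cball x1 (R / 2) \<times> UNIV)"
      using \<open>closed X\<close> by (intro closed_epi_scalarization_over closed_Int closed_cball)
    then have "closed ((?E \<inter> cball x1 (R / 2) \<times> UNIV) \<inter> cball ?b (R / 2))"
      using closed_Int closed_cball by blast
    moreover have "cball ?b (R / 2) \<subseteq> cball x1 (R / 2) \<times> UNIV"
    proof
      fix p assume "p \<in> cball ?b (R / 2)"
      then show "p \<in> cball x1 (R / 2) \<times> UNIV"
        using dist_fst_le[of ?b p] by (simp add: mem_Times_iff)
    qed
    ultimately show ?thesis
      by (metis (no_types, lifting) Int_absorb1 Int_assoc)
  qed
  obtain \<eta> where "\<eta> > 0" and \<eta>: "\<And>p. p \<in> ?G \<Longrightarrow> norm (p - p1) < \<eta> \<Longrightarrow>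
      (v1, z1') \<bullet> (p - p1) \<le> e * norm (p - p1)"
    using reg1 \<open>e > 0\<close> unfolding regular_normal_cone_iff by blast
  define \<theta> where "\<theta> = min (R / 2) (\<eta> / (1 + L))"
  have "\<theta> > 0" using \<open>R > 0\<close> \<open>\<eta> > 0\<close> \<open>L \<ge> 0\<close> by (simp add: \<theta>_def)
  define \<kappa> where "\<kappa> = e * (1 + 2 * L)"
  have "\<kappa> \<ge> 0" using \<open>e > 0\<close> \<open>L \<ge> 0\<close> by (simp add: \<kappa>_def)
  have almost: "(v1, - 1) \<bullet> (p - ?b) \<le> \<kappa> * norm (p - ?b)"
    if "p \<in> ?E" "norm (p - ?b) < \<theta>" for p
  proof -
    obtain y \<alpha> where p: "p = (y, \<alpha>)" by (cases p) auto
    have y: "y \<in> X" "z \<bullet> F y \<le> \<alpha>" using that(1) by (auto simp: p mem_epi_scalarization)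
    have yp: "norm (y - x1) \<le> norm (p - ?b)"
      using norm_fst_le[of "y - x1" "\<alpha> - z \<bullet> F x1"] by (simp add: p)
    then have small: "norm (y - x1) < R / 2" "norm (y - x1) < \<eta> / (1 + L)"
      using that(2) by (simp_all add: \<theta>_def)
    have "y \<in> V"
    proof (rule subsetD[OF ball1])
      show "y \<in> cball x1 (R / 2)" using small by (simp add: dist_norm norm_minus_commute)
    qed
    have FL: "norm (F y - F x1) \<le> L * norm (y - x1)"
      using lipD y \<open>y \<in> V\<close> \<open>x1 \<in> X\<close> \<open>x1 \<in> V\<close> by blast
    have graph_dist: "norm ((y, F y) - p1) \<le> (1 + L) * norm (y - x1)"
      using norm_Pair_le[of "y - x1" "F y - F x1"] FL by (simp add: p1 algebra_simps)
    also have "\<dots> < \<eta>" using small \<open>L \<ge> 0\<close> by (simp add: pos_less_divide_eq mult.commute)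
    finally have "(v1, z1') \<bullet> ((y, F y) - p1) \<le> e * norm ((y, F y) - p1)"
      using y by (intro \<eta>) (simp add: gph_restr_single_valued)
    also have "\<dots> \<le> e * ((1 + L) * norm (y - x1))"
      using graph_dist \<open>e > 0\<close> by (intro mult_left_mono) auto
    finally have 1: "v1 \<bullet> (y - x1) + z1' \<bullet> (F y - F x1) \<le> e * ((1 + L) * norm (y - x1))"
      by (simp only: p1 diff_Pair inner_Pair)
    have "- ((z1' + z) \<bullet> (F y - F x1)) \<le> norm (z1' + z) * norm (F y - F x1)"
      using Cauchy_Schwarz_ineq2[of "z1' + z" "F y - F x1"] by linarith
    also have "\<dots> \<le> e * (L * norm (y - x1))"
      using n1(4) FL \<open>e > 0\<close> by (intro mult_mono) auto
    finally have 2: "- (z1' \<bullet> (F y - F x1)) - z \<bullet> (F y - F x1) \<le> e * (L * norm (y - x1))"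
      by (simp add: inner_add_left)
    have "(v1, - 1) \<bullet> (p - ?b) = v1 \<bullet> (y - x1) - (\<alpha> - z \<bullet> F x1)"
      by (simp add: p)
    also have "\<dots> \<le> v1 \<bullet> (y - x1) - z \<bullet> (F y - F x1)"
      using y(2) by (simp add: inner_diff_right)
    also have "\<dots> \<le> \<kappa> * norm (y - x1)"
      using 1 2 by (simp add: \<kappa>_def algebra_simps)
    also have "\<dots> \<le> \<kappa> * norm (p - ?b)"
      using yp \<open>\<kappa> \<ge> 0\<close> by (rule mult_left_mono)
    finally show ?thesis .
  qed
  obtain b' a' where reg: "a' \<in> regular_normal_cone ?E b'"
    and b': "norm (b' - ?b) < e" and a': "norm (a' - (v1, - 1)) \<le> 2 * \<kappa>"
    by (rule regular_normal_near_almost_normal[OF bE \<open>R / 2 > 0\<close> cl \<open>\<kappa> \<ge> 0\<close> \<open>e > 0\<close> \<open>\<theta> > 0\<close> almost])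
      blast+
  have "dist b' (x, z \<bullet> F x) < \<epsilon>"
  proof -
    have "\<bar>z \<bullet> (F x1 - F x)\<bar> \<le> norm z * norm (F x1 - F x)"
      by (rule Cauchy_Schwarz_ineq2)
    also have "\<dots> \<le> norm z * e" using n1(2) by (intro mult_left_mono) auto
    finally have "norm (?b - (x, z \<bullet> F x)) < e + norm z * e"
      using norm_Pair_le[of "x1 - x" "z \<bullet> (F x1 - F x)"] n1(1) by (simp add: inner_diff_right)
    then have "norm (b' - (x, z \<bullet> F x)) < e + (e + norm z * e)"
      using b' dist_triangle[of b' "(x, z \<bullet> F x)" ?b] unfolding dist_norm by linarith
    moreover have "e * L \<ge> 0" using \<open>e > 0\<close> \<open>L \<ge> 0\<close> by simp
    ultimately show ?thesis
      using eM \<open>e > 0\<close> by (simp add: dist_norm mult.commute)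
  qed
  moreover have "dist a' (v, - 1) < \<epsilon>"
  proof -
    have "norm ((v1, - 1) - (v, - 1 :: real)) < e" using n1(3) by simp
    then have "norm (a' - (v, - 1)) < 2 * \<kappa> + e"
      using a' dist_triangle[of a' "(v, - 1)" "(v1, - 1)"] unfolding dist_norm by linarith
    moreover have "2 * \<kappa> = 2 * e + 4 * (e * L)" by (simp add: \<kappa>_def algebra_simps)
    moreover have "e * norm z \<ge> 0" using \<open>e > 0\<close> by simp
    ultimately show ?thesis
      using eM \<open>e > 0\<close> unfolding dist_norm by linarith
  qed
  ultimately show "\<exists>b w. w \<in> regular_normal_cone ?E b \<and> dist b (x, z \<bullet> F x) < \<epsilon> \<and> dist w (v, - 1) < \<epsilon>"
    using reg by blast
qed

text \<open>
  Regularity of the epigraph turns the limiting normal \<open>(v, - 1)\<close> into a first-order lower bound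
  \<open>z \<bullet> (F y - F x) \<ge> v \<bullet> (y - x)\<close> for \<open>y\<close> in \<open>X\<close>. Adding the first-order inequality of the regular normal
  \<open>(z, q)\<close> of the graph of \<open>S\<^sub>0\<close> at \<open>(F y, s)\<close> eliminates \<open>z\<close>; by Lipschitz continuity all error terms are
  small relative to \<open>norm ((y, s) - (x, u))\<close>.
\<close>
lemma regular_chain_rule:
  fixes F :: "'a::euclidean_space \<Rightarrow> 'b::euclidean_space"
    and S\<^sub>0 :: "('b, 'c::euclidean_space) setmap"
  assumes "closed X" and "open V" and "x \<in> V" and lip: "L-lipschitz_on (X \<inter> V) F"
    and "u \<in> S\<^sub>0 (F x)" and regS: "graphically_regular S\<^sub>0 (F x) u"
    and regF: "regular_function (scalarization z F X) x"
    and z1: "(z, q) \<in> normal_cone (gph S\<^sub>0) (F x, u)"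
    and z2: "(v, - z) \<in> normal_cone (gph (restr (single_valued_map F) X)) (x, F x)"
  shows "(v, q) \<in> regular_normal_cone (gph (restr (comp_map S\<^sub>0 (single_valued_map F)) X)) (x, u)"
  unfolding regular_normal_cone_iff
proof (intro conjI allI impI)
  let ?H = "gph (restr (comp_map S\<^sub>0 (single_valued_map F)) X)"
  let ?E = "epi (scalarization z F X)"
  have "x \<in> X"
    using z2 by (auto simp: normal_cone_def gph_restr_single_valued)
  then show "(x, u) \<in> ?H"
    using \<open>u \<in> S\<^sub>0 (F x)\<close> by (simp add: gph_restr_comp_single_valued)
  have "L \<ge> 0" using lip by (rule lipschitz_on_nonneg)
  have "(v, - 1) \<in> normal_cone ?E (x, z \<bullet> F x)"
    using assms by (intro normal_cone_epi_scalarization)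
  moreover have "real_of_ereal (scalarization z F X x) = z \<bullet> F x"
    using \<open>x \<in> X\<close> by (simp add: scalarization_def)
  ultimately have regE: "(v, - 1) \<in> regular_normal_cone ?E (x, z \<bullet> F x)"
    using regF unfolding regular_function_def clarke_regular_def by simp
  have regS': "(z, q) \<in> regular_normal_cone (gph S\<^sub>0) (F x, u)"
    using regS z1 unfolding graphically_regular_def clarke_regular_def by simp
  obtain R where "R > 0" and R: "ball x R \<subseteq> V"
    using \<open>open V\<close> \<open>x \<in> V\<close> open_contains_ball by blast
  fix \<epsilon> :: real assume "\<epsilon> > 0"
  \<comment> \<open>\<open>n * M\<close> bounds the distances at which the two regular normals are tested, where \<open>n\<close> is the
    distance to \<open>(x, u)\<close>; the same factor collects their errors.\<close>
  define M where "M = 2 + L + norm z * L"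
  have zL: "norm z * L \<ge> 0" using \<open>L \<ge> 0\<close> by simp
  have "M > 0" using \<open>L \<ge> 0\<close> zL unfolding M_def by linarith
  define e where "e = \<epsilon> / M"
  have "e > 0" and eM: "e * M = \<epsilon>" using \<open>\<epsilon> > 0\<close> \<open>M > 0\<close> by (simp_all add: e_def)
  obtain d1 where "d1 > 0" and d1: "\<And>p. p \<in> ?E \<Longrightarrow> norm (p - (x, z \<bullet> F x)) < d1 \<Longrightarrow>
      (v, - 1) \<bullet> (p - (x, z \<bullet> F x)) \<le> e * norm (p - (x, z \<bullet> F x))"
    using regE \<open>e > 0\<close> unfolding regular_normal_cone_iff by blast
  obtain d2 where "d2 > 0" and d2: "\<And>p. p \<in> gph S\<^sub>0 \<Longrightarrow> norm (p - (F x, u)) < d2 \<Longrightarrow>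
      (z, q) \<bullet> (p - (F x, u)) \<le> e * norm (p - (F x, u))"
    using regS' \<open>e > 0\<close> unfolding regular_normal_cone_iff by blast
  define \<delta> where "\<delta> = min R (min d1 d2 / M)"
  have "\<delta> > 0" using \<open>R > 0\<close> \<open>d1 > 0\<close> \<open>d2 > 0\<close> \<open>M > 0\<close> by (simp add: \<delta>_def)
  have "(v, q) \<bullet> (p - (x, u)) \<le> \<epsilon> * norm (p - (x, u))" if "p \<in> ?H" "norm (p - (x, u)) < \<delta>" for p
  proof -
    obtain y s where p: "p = (y, s)" by (cases p) auto
    have y: "y \<in> X" "s \<in> S\<^sub>0 (F y)" using that(1) by (auto simp: p gph_restr_comp_single_valued)
    define n where "n = norm (p - (x, u))"
    have "n \<ge> 0" by (simp add: n_def)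
    have yn: "norm (y - x) \<le> n" and sn: "norm (s - u) \<le> n"
      using norm_fst_le[of "y - x" "s - u"] norm_snd_le[of "s - u" "y - x"] by (simp_all add: n_def p)
    have nd: "n < R" "n < min d1 d2 / M" using that(2) by (simp_all add: n_def \<delta>_def)
    have nM: "n * M < d1" "n * M < d2" using nd(2) \<open>M > 0\<close> by (simp_all add: pos_less_divide_eq)
    have "y \<in> V"
      using yn nd(1) by (intro subsetD[OF R]) (simp add: dist_norm norm_minus_commute)
    have "norm (F y - F x) \<le> L * norm (y - x)"
      using lipschitz_onD[OF lip, of y x] y \<open>y \<in> V\<close> \<open>x \<in> X\<close> \<open>x \<in> V\<close> by (simp add: dist_norm)
    also have "\<dots> \<le> L * n" using yn \<open>L \<ge> 0\<close> by (rule mult_left_mono)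
    finally have FL: "norm (F y - F x) \<le> L * n" .
    have "\<bar>z \<bullet> (F y - F x)\<bar> \<le> norm z * norm (F y - F x)"
      by (rule Cauchy_Schwarz_ineq2)
    also have "\<dots> \<le> norm z * (L * n)" using FL by (intro mult_left_mono) auto
    finally have zF: "\<bar>z \<bullet> (F y - F x)\<bar> \<le> norm z * L * n" by (simp add: mult.assoc)
    have Mn: "n * M = 2 * n + L * n + norm z * L * n" by (simp add: M_def algebra_simps)
    have nn: "L * n \<ge> 0" "norm z * L * n \<ge> 0" using \<open>L \<ge> 0\<close> zL \<open>n \<ge> 0\<close> by simp_all
    have 1: "norm ((y, z \<bullet> F y) - (x, z \<bullet> F x)) \<le> n + norm z * L * n"
      using norm_Pair_le[of "y - x" "z \<bullet> (F y - F x)"] yn zF by (simp add: inner_diff_right)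
    have "(v, - 1) \<bullet> ((y, z \<bullet> F y) - (x, z \<bullet> F x)) \<le> e * norm ((y, z \<bullet> F y) - (x, z \<bullet> F x))"
      using 1 nM(1) Mn nn \<open>n \<ge> 0\<close> y by (intro d1) (simp_all add: mem_epi_scalarization)
    also have "\<dots> \<le> e * (n + norm z * L * n)"
      using 1 \<open>e > 0\<close> by (intro mult_left_mono) auto
    finally have A: "v \<bullet> (y - x) - z \<bullet> (F y - F x) \<le> e * (n + norm z * L * n)"
      by (simp add: inner_diff_right)
    have 2: "norm ((F y, s) - (F x, u)) \<le> L * n + n"
      using norm_Pair_le[of "F y - F x" "s - u"] FL sn by simp
    have "(z, q) \<bullet> ((F y, s) - (F x, u)) \<le> e * norm ((F y, s) - (F x, u))"
      using 2 nM(2) Mn nn \<open>n \<ge> 0\<close> y by (intro d2) (simp_all add: mem_gph_iff)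
    also have "\<dots> \<le> e * (L * n + n)"
      using 2 \<open>e > 0\<close> by (intro mult_left_mono) auto
    finally have B: "z \<bullet> (F y - F x) + q \<bullet> (s - u) \<le> e * (L * n + n)"
      by (simp only: diff_Pair inner_Pair)
    have "(v, q) \<bullet> (p - (x, u)) \<le> e * (n + norm z * L * n) + e * (L * n + n)"
      using A B by (simp add: p)
    also have "\<dots> = e * M * n" by (simp add: M_def algebra_simps)
    finally show ?thesis by (simp only: eM n_def)
  qed
  then show "\<exists>\<delta>>0. \<forall>p\<in>?H. norm (p - (x, u)) < \<delta> \<longrightarrow> (v, q) \<bullet> (p - (x, u)) \<le> \<epsilon> * norm (p - (x, u))"
    using \<open>\<delta> > 0\<close> by blast
qed

lemma locally_closed_gph_comp:
  fixes F :: "'a::metric_space \<Rightarrow> 'b::metric_space"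
    and S\<^sub>0 :: "('b, 'c::metric_space) setmap"
  assumes "closed X" and "closed (gph S\<^sub>0)" and "open V" and "x \<in> V" and "continuous_on (X \<inter> V) F"
  shows "locally_closed_at (gph (restr (comp_map S\<^sub>0 (single_valued_map F)) X)) (x, u)"
proof -
  let ?H = "gph (restr (comp_map S\<^sub>0 (single_valued_map F)) X)"
  obtain R where "R > 0" and R: "cball x R \<subseteq> V"
    using \<open>open V\<close> \<open>x \<in> V\<close> open_contains_cball by blast
  have "closed (?H \<inter> cball x R \<times> UNIV)"
    using assms R by (intro closed_gph_comp_over closed_Int closed_cball) (auto intro: continuous_on_subset)
  moreover have "(x, u) \<in> interior (cball x R \<times> UNIV)"
    using \<open>R > 0\<close> by (intro interiorI[of "ball x R \<times> UNIV"] open_Times) auto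
  ultimately show ?thesis
    unfolding locally_closed_at_def by (intro exI[of _ "cball x R \<times> UNIV"]) (simp add: closed_Times)
qed

section \<open>Tangents and normals of a smooth manifold\<close>

lemma span_image_finite:
  fixes f :: "'i \<Rightarrow> 'a::real_vector"
  assumes "finite I"
  shows "span (f ` I) = range (\<lambda>c. \<Sum>i\<in>I. c i *\<^sub>R f i)"
proof
  have "subspace (range (\<lambda>c. \<Sum>i\<in>I. c i *\<^sub>R f i))"
  proof (rule subspaceI)
    show "0 \<in> range (\<lambda>c. \<Sum>i\<in>I. c i *\<^sub>R f i)"
      by (rule range_eqI[of _ _ "\<lambda>_. 0"]) simp
  next
    fix a b assume "a \<in> range (\<lambda>c. \<Sum>i\<in>I. c i *\<^sub>R f i)" "b \<in> range (\<lambda>c. \<Sum>i\<in>I. c i *\<^sub>R f i)"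
    then obtain c d where "a = (\<Sum>i\<in>I. c i *\<^sub>R f i)" "b = (\<Sum>i\<in>I. d i *\<^sub>R f i)" by blast
    then show "a + b \<in> range (\<lambda>c. \<Sum>i\<in>I. c i *\<^sub>R f i)"
      by (intro range_eqI[of _ _ "\<lambda>i. c i + d i"]) (simp add: scaleR_add_left sum.distrib)
  next
    fix r a assume "a \<in> range (\<lambda>c. \<Sum>i\<in>I. c i *\<^sub>R f i)"
    then obtain c where "a = (\<Sum>i\<in>I. c i *\<^sub>R f i)" by blast
    then show "r *\<^sub>R a \<in> range (\<lambda>c. \<Sum>i\<in>I. c i *\<^sub>R f i)"
      by (intro range_eqI[of _ _ "\<lambda>i. r * c i"]) (simp add: scaleR_sum_right)
  qed
  moreover have "f i \<in> range (\<lambda>c. \<Sum>i\<in>I. c i *\<^sub>R f i)" if "i \<in> I" for i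
    using that assms
    by (intro range_eqI[of _ _ "\<lambda>j. if j = i then 1 else 0"])
      (simp add: if_distrib[of "\<lambda>r. r *\<^sub>R _"] cong: if_cong)
  ultimately show "span (f ` I) \<subseteq> range (\<lambda>c. \<Sum>i\<in>I. c i *\<^sub>R f i)"
    by (intro span_minimal) auto
  show "range (\<lambda>c. \<Sum>i\<in>I. c i *\<^sub>R f i) \<subseteq> span (f ` I)"
    by (intro image_subsetI span_sum span_scale span_base imageI)
qed

lemma sum_eq_0_imp_coeff_0:
  fixes f :: "nat \<Rightarrow> 'a::euclidean_space"
  assumes full_rank: "dim (span (f ` {..<n})) = n" and zero: "(\<Sum>i<n. c i *\<^sub>R f i) = 0" and "i < n"
  shows "c i = 0"
proof -
  have "n \<le> card (f ` {..<n})"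
    using dim_le_card[of "span (f ` {..<n})" "f ` {..<n}"] full_rank by simp
  then have card: "card (f ` {..<n}) = n"
    using card_image_le[of "{..<n}" f] by simp
  then have inj: "inj_on f {..<n}"
    by (simp add: inj_on_iff_eq_card)
  have indep: "independent (f ` {..<n})"
    using card_eq_dim[of "f ` {..<n}" "span (f ` {..<n})"] card full_rank by (simp add: span_superset)
  have "(\<Sum>v\<in>f ` {..<n}. c (the_inv_into {..<n} f v) *\<^sub>R v) = (\<Sum>i<n. c i *\<^sub>R f i)"
    by (subst sum.reindex[OF inj]) (auto intro!: sum.cong simp: the_inv_into_f_f[OF inj])
  then have "c (the_inv_into {..<n} f (f i)) = 0"
    using independentD[OF indep _ order_refl, of "\<lambda>v. c (the_inv_into {..<n} f v)" "f i"] zero \<open>i < n\<close>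
    by simp
  then show ?thesis
    using \<open>i < n\<close> by (simp add: the_inv_into_f_f[OF inj])
qed

lemma regular_normal_inner_tangent_le_0:
  fixes C :: "'a::euclidean_space set"
  assumes w: "w \<in> regular_normal_cone C x" and t: "t \<in> tangent_cone C x"
  shows "w \<bullet> t \<le> 0"
proof -
  obtain \<tau> ys where pos: "\<And>k::nat. \<tau> k > 0" and C: "\<And>k. ys k \<in> C" and \<tau>: "\<tau> \<longlonglongrightarrow> 0"
    and lim: "(\<lambda>k. (ys k - x) /\<^sub>R \<tau> k) \<longlonglongrightarrow> t"
    using t unfolding tangent_cone_iff by blast
  have "(\<lambda>k. \<tau> k *\<^sub>R ((ys k - x) /\<^sub>R \<tau> k)) \<longlonglongrightarrow> 0 *\<^sub>R t"
    by (intro tendsto_scaleR \<tau> lim)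
  moreover have "\<tau> k *\<^sub>R ((ys k - x) /\<^sub>R \<tau> k) = ys k - x" for k
    using pos[of k] by simp
  ultimately have to0: "(\<lambda>k. ys k - x) \<longlonglongrightarrow> 0" by simp
  have "w \<bullet> t \<le> \<epsilon> * norm t" if "\<epsilon> > 0" for \<epsilon>
  proof -
    obtain \<delta> where "\<delta> > 0" and \<delta>: "\<And>y. y \<in> C \<Longrightarrow> norm (y - x) < \<delta> \<Longrightarrow> w \<bullet> (y - x) \<le> \<epsilon> * norm (y - x)"
      using w \<open>\<epsilon> > 0\<close> unfolding regular_normal_cone_iff by blast
    have "\<forall>\<^sub>F k in sequentially. norm (ys k - x) < \<delta>"
      using tendstoD[OF to0 \<open>\<delta> > 0\<close>] by simp
    then have "\<forall>\<^sub>F k in sequentially.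
        w \<bullet> ((ys k - x) /\<^sub>R \<tau> k) \<le> \<epsilon> * norm ((ys k - x) /\<^sub>R \<tau> k)"
    proof (rule eventually_mono)
      fix k assume "norm (ys k - x) < \<delta>"
      then have "inverse (\<tau> k) * (w \<bullet> (ys k - x)) \<le> inverse (\<tau> k) * (\<epsilon> * norm (ys k - x))"
        using \<delta>[OF C] pos[of k] by (intro mult_left_mono) auto
      then show "w \<bullet> ((ys k - x) /\<^sub>R \<tau> k) \<le> \<epsilon> * norm ((ys k - x) /\<^sub>R \<tau> k)"
        using pos[of k] by (simp add: mult.left_commute)
    qed
    then show ?thesis
      by (rule tendsto_le[OF sequentially_bot, rotated 2]) (intro tendsto_intros lim)+
  qed
  note bound = this
  have "w \<bullet> t \<le> 0 + e" if "e > 0" for e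
  proof -
    have pos: "norm t + 1 > 0" using norm_ge_zero[of t] by linarith
    then have "w \<bullet> t \<le> e / (norm t + 1) * norm t"
      using \<open>e > 0\<close> by (intro bound) simp
    also have "\<dots> \<le> e" using pos \<open>e > 0\<close> by (simp add: field_simps)
    finally show ?thesis by simp
  qed
  then show ?thesis by (rule field_le_epsilon)
qed

text \<open>
  On \<open>X\<close> the function does not change, so that its first-order term vanishes up to the error of differentiation.
\<close>
lemma gradient_regular_normal:
  fixes g :: "'a::euclidean_space \<Rightarrow> real"
  assumes "GDERIV g y :> D" and "open U" and "y \<in> X \<inter> U" and const: "\<And>y'. y' \<in> X \<inter> U \<Longrightarrow> g y' = g y"
  shows "c *\<^sub>R D \<in> regular_normal_cone X y"
  unfolding regular_normal_cone_iff
proof (intro conjI allI impI)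
  show "y \<in> X" using assms by simp
  obtain r where "r > 0" and r: "ball y r \<subseteq> U"
    using \<open>open U\<close> assms(3) open_contains_ball by blast
  fix \<epsilon> :: real assume "\<epsilon> > 0"
  then have "\<epsilon> / (\<bar>c\<bar> + 1) > 0" by simp
  then obtain d where "d > 0" and d: "\<And>y'. norm (y' - y) < d \<Longrightarrow>
      norm (g y' - g y - (y' - y) \<bullet> D) \<le> \<epsilon> / (\<bar>c\<bar> + 1) * norm (y' - y)"
    using assms(1) unfolding gderiv_def has_derivative_at_alt by blast
  have "(c *\<^sub>R D) \<bullet> (y' - y) \<le> \<epsilon> * norm (y' - y)" if "y' \<in> X" "norm (y' - y) < min d r" for y'
  proof -
    have "y' \<in> X \<inter> U" using that r by (auto simp: dist_norm norm_minus_commute)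
    then have "\<bar>(y' - y) \<bullet> D\<bar> \<le> \<epsilon> / (\<bar>c\<bar> + 1) * norm (y' - y)"
      using d[of y'] const that by simp
    then have "\<bar>c\<bar> * \<bar>(y' - y) \<bullet> D\<bar> \<le> \<bar>c\<bar> * (\<epsilon> / (\<bar>c\<bar> + 1) * norm (y' - y))"
      by (intro mult_left_mono) auto
    also have "\<dots> = \<bar>c\<bar> / (\<bar>c\<bar> + 1) * (\<epsilon> * norm (y' - y))" by simp
    also have "\<dots> \<le> 1 * (\<epsilon> * norm (y' - y))"
      using \<open>\<epsilon> > 0\<close> by (intro mult_right_mono) (auto simp: divide_le_eq)
    finally have "\<bar>c * ((y' - y) \<bullet> D)\<bar> \<le> \<epsilon> * norm (y' - y)" by (simp add: abs_mult)
    then show ?thesis by (simp add: inner_commute)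
  qed
  then show "\<exists>\<delta>>0. \<forall>y'\<in>X. norm (y' - y) < \<delta> \<longrightarrow> (c *\<^sub>R D) \<bullet> (y' - y) \<le> \<epsilon> * norm (y' - y)"
    using \<open>d > 0\<close> \<open>r > 0\<close> by (intro exI[of _ "min d r"]) simp
qed

lemma regular_normal_cone_sum:
  fixes C :: "'a::euclidean_space set"
  assumes "x \<in> C" and "\<And>i. i \<in> I \<Longrightarrow> f i \<in> regular_normal_cone C x"
  shows "sum f I \<in> regular_normal_cone C x"
proof -
  have "0 \<in> regular_normal_cone C x"
    unfolding regular_normal_cone_iff using \<open>x \<in> C\<close> by (auto intro!: exI[of _ 1])
  then show ?thesis
    using assms(2) by (induction I rule: infinite_finite_induct) (auto intro: regular_normal_cone_add)
qed

text \<open>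
  The difference quotients along \<open>t = r / (k + 2)\<close> converge to the velocity; starting with \<open>r / 2\<close> keeps all
  parameters strictly below \<open>r\<close>.
\<close>
lemma curve_velocity_in_tangent_cone:
  fixes g :: "'b::euclidean_space \<Rightarrow> 'a::euclidean_space"
  assumes deriv: "(g has_derivative g') (at p)" and "g p \<in> X" and "r > 0"
    and inX: "\<And>t. 0 < t \<Longrightarrow> t < r \<Longrightarrow> g (p + t *\<^sub>R a) \<in> X"
  shows "g' a \<in> tangent_cone X (g p)"
proof (cases "a = 0")
  case True
  then show ?thesis
    using deriv \<open>g p \<in> X\<close> by (simp add: linear_0[OF has_derivative_linear] zero_in_tangent_cone)
next
  case False
  define t where "t k = r * inverse (real (Suc (Suc k)))" for k
  have t: "0 < t k" "t k < r" for k
  proof -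
    show "0 < t k" using \<open>r > 0\<close> by (simp add: t_def)
    have "r * inverse (real (Suc (Suc k))) < r * 1"
      using \<open>r > 0\<close> by (intro mult_strict_left_mono) (auto simp: inverse_less_1_iff)
    then show "t k < r" by (simp add: t_def)
  qed
  have "(\<lambda>k. inverse (real (Suc (Suc k)))) \<longlonglongrightarrow> 0"
    by (rule LIMSEQ_Suc[OF LIMSEQ_inverse_real_of_nat])
  then have "(\<lambda>k. r * inverse (real (Suc (Suc k)))) \<longlonglongrightarrow> r * 0"
    by (intro tendsto_mult tendsto_const)
  then have t0: "t \<longlonglongrightarrow> 0" by (simp add: t_def[abs_def])
  have lin: "linear g'" using deriv by (rule has_derivative_linear)
  have "((\<lambda>h. norm (g (p + h) - g p - g' h) / norm h) \<longlongrightarrow> 0) (at 0)"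
    using deriv unfolding has_derivative_at by blast
  moreover have "filterlim (\<lambda>k. t k *\<^sub>R a) (at 0) sequentially"
  proof -
    have "(\<lambda>k. t k *\<^sub>R a) \<longlonglongrightarrow> 0 *\<^sub>R a"
      by (intro tendsto_scaleR t0 tendsto_const)
    moreover have "t k *\<^sub>R a \<noteq> 0" for k using False t(1)[of k] by simp
    ultimately show ?thesis by (simp add: filterlim_at)
  qed
  ultimately have "(\<lambda>k. norm (g (p + t k *\<^sub>R a) - g p - g' (t k *\<^sub>R a)) / norm (t k *\<^sub>R a)) \<longlonglongrightarrow> 0"
    by (rule filterlim_compose)
  then have "(\<lambda>k. norm a * (norm (g (p + t k *\<^sub>R a) - g p - g' (t k *\<^sub>R a)) / norm (t k *\<^sub>R a)))
      \<longlonglongrightarrow> norm a * 0"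
    by (intro tendsto_mult tendsto_const)
  moreover have "norm a * (norm (g (p + t k *\<^sub>R a) - g p - g' (t k *\<^sub>R a)) / norm (t k *\<^sub>R a))
      = norm ((g (p + t k *\<^sub>R a) - g p) /\<^sub>R t k - g' a)" for k
  proof -
    have "(g (p + t k *\<^sub>R a) - g p) /\<^sub>R t k - g' a = (g (p + t k *\<^sub>R a) - g p - g' (t k *\<^sub>R a)) /\<^sub>R t k"
      using t(1)[of k] by (simp add: linear_scale[OF lin] scaleR_diff_right)
    then show ?thesis
      using t(1)[of k] False by (simp add: divide_inverse)
  qed
  ultimately have "(\<lambda>k. norm ((g (p + t k *\<^sub>R a) - g p) /\<^sub>R t k - g' a)) \<longlonglongrightarrow> 0" by simp
  then have "(\<lambda>k. (g (p + t k *\<^sub>R a) - g p) /\<^sub>R t k) \<longlonglongrightarrow> g' a"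
    by (simp add: tendsto_norm_zero_iff LIM_zero_iff)
  then show ?thesis
    unfolding tangent_cone_iff using t t0 inX \<open>g p \<in> X\<close>
    by (intro conjI exI[of _ t] exI[of _ "\<lambda>k. g (p + t k *\<^sub>R a)"]) auto
qed

text \<open>
  Near \<open>x\<close> the gradients of the defining functions span normals, and the vectors orthogonal to them are
  exactly the tangents. That orthogonal vectors are tangents is the part that needs full rank. Complete the
  gradients at \<open>x\<close> by a basis \<open>B\<close> of the orthogonal complement of their span and set
  \<open>\<Phi> y = (\<Sum>i<n. G i y *\<^sub>R D i x) + (\<Sum>b\<in>B. (y \<bullet> b) *\<^sub>R b)\<close>. The derivative of \<open>\<Phi>\<close> at \<open>x\<close> is injective, since pairing it
  with its argument gives a sum of squares. If \<open>w\<close> is orthogonal to the gradients at \<open>y\<close>, then the derivative of \<open>\<Phi>\<close>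
  at \<open>y\<close> maps \<open>w\<close> into the span of \<open>B\<close>, and the local inverse of \<open>\<Phi>\<close> maps the line through \<open>\<Phi> y\<close> in this direction to a curve
  with velocity \<open>w\<close>. Along the line the component of \<open>\<Phi>\<close> in the span of the gradients at \<open>x\<close> stays zero, and as
  these are linearly independent, the curve stays in \<open>X\<close>.
\<close>
lemma smooth_manifold_cones:
  fixes X :: "'a::euclidean_space set"
  assumes "smooth_manifold_around d X x"
  obtains W n and D :: "nat \<Rightarrow> 'a \<Rightarrow> 'a" where "open W" "x \<in> W"
    "\<And>i. i < n \<Longrightarrow> continuous_on W (D i)"
    "\<And>y c. y \<in> X \<inter> W \<Longrightarrow> (\<Sum>i<n. c i *\<^sub>R D i y) \<in> regular_normal_cone X y"
    "\<And>y w. y \<in> X \<inter> W \<Longrightarrow> w \<in> tangent_cone X y \<longleftrightarrow> (\<forall>i<n. w \<bullet> D i y = 0)"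
proof -
  define n where "n = DIM('a) - d"
  obtain U and G :: "nat \<Rightarrow> 'a \<Rightarrow> real" and D where chart: "open U \<and> x \<in> U \<and>
      (\<forall>i<n. (\<forall>y\<in>U. GDERIV (G i) y :> D i y) \<and> continuous_on U (D i)) \<and>
      dim (span ((\<lambda>i. D i x) ` {..<n})) = n \<and> X \<inter> U = {y \<in> U. \<forall>i<n. G i y = 0}"
    using assms unfolding smooth_manifold_around_def n_def[symmetric] by (elim conjE exE) (rule that, simp)
  then have "open U" "x \<in> U"
    and derG: "\<And>i y. i < n \<Longrightarrow> y \<in> U \<Longrightarrow> GDERIV (G i) y :> D i y"
    and contD: "\<And>i. i < n \<Longrightarrow> continuous_on U (D i)"
    and rank: "dim (span ((\<lambda>i. D i x) ` {..<n})) = n"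
    and X: "X \<inter> U = {y \<in> U. \<forall>i<n. G i y = 0}"
    by simp_all
  have G0: "G i y = 0" if "y \<in> X \<inter> U" "i < n" for i y
    using that X by blast
  have normals: "(\<Sum>i<n. c i *\<^sub>R D i y) \<in> regular_normal_cone X y" if "y \<in> X \<inter> U" for y c
  proof (rule regular_normal_cone_sum)
    show "y \<in> X" using that by simp
    fix i assume "i \<in> {..<n}"
    then show "c i *\<^sub>R D i y \<in> regular_normal_cone X y"
      using that G0 by (intro gradient_regular_normal[OF derG \<open>open U\<close>]) auto
  qed
  let ?N = "span ((\<lambda>i. D i x) ` {..<n})"
  obtain B where "finite B" and B: "span B = ?N\<^sup>\<bottom>"
  proof -
    obtain B where BN: "B \<subseteq> ?N\<^sup>\<bottom>" and indep: "independent B" and NB: "?N\<^sup>\<bottom> \<subseteq> span B"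
      by (rule basis_exists)
    have "span B \<subseteq> ?N\<^sup>\<bottom>"
      by (rule span_minimal[OF BN subspace_orthogonal_comp])
    then have "span B = ?N\<^sup>\<bottom>"
      using NB by (rule equalityI)
    with independent_imp_finite[OF indep] show thesis by (rule that)
  qed
  define \<Phi> where "\<Phi> y = (\<Sum>i<n. G i y *\<^sub>R D i x) + (\<Sum>b\<in>B. (y \<bullet> b) *\<^sub>R b)" for y
  define \<Phi>' where "\<Phi>' y h = (\<Sum>i<n. (h \<bullet> D i y) *\<^sub>R D i x) + (\<Sum>b\<in>B. (h \<bullet> b) *\<^sub>R b)" for y h
  have lin: "bounded_linear (\<Phi>' y)" for y
    unfolding \<Phi>'_def by (intro bounded_linear_add bounded_linear_sum bounded_linear_scaleR_const
        bounded_linear_inner_left)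
  have app: "blinfun_apply (Blinfun (\<Phi>' y)) = \<Phi>' y" for y
    by (rule bounded_linear_Blinfun_apply[OF lin])
  have der: "(\<Phi> has_derivative blinfun_apply (Blinfun (\<Phi>' y))) (at y)" if "y \<in> U" for y
    unfolding app unfolding \<Phi>_def \<Phi>'_def
  proof (intro has_derivative_add has_derivative_sum has_derivative_scaleR_left)
    show "(G i has_derivative (\<lambda>h. h \<bullet> D i y)) (at y)" if "i \<in> {..<n}" for i
      using derG[of i y] that \<open>y \<in> U\<close> by (simp add: gderiv_def)
    show "((\<lambda>y. y \<bullet> b) has_derivative (\<lambda>h. h \<bullet> b)) (at y)" for b
      by (rule bounded_linear_imp_has_derivative[OF bounded_linear_inner_left])
  qed
  have cont: "continuous_on U (\<lambda>y. Blinfun (\<Phi>' y))"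
  proof (rule continuous_on_blinfun_componentwise)
    fix h :: 'a
    show "continuous_on U (\<lambda>y. blinfun_apply (Blinfun (\<Phi>' y)) h)"
      unfolding app \<Phi>'_def using contD by (intro continuous_intros) auto
  qed
  have inj: "inj (\<Phi>' x)"
    unfolding linear_injective_0[OF bounded_linear.linear[OF lin]]
  proof (intro allI impI)
    fix h assume "\<Phi>' x h = 0"
    \<comment> \<open>This inner product is a sum of squares.\<close>
    then have "h \<bullet> \<Phi>' x h = 0" by simp
    then have "(\<Sum>i<n. (h \<bullet> D i x)\<^sup>2) + (\<Sum>b\<in>B. (h \<bullet> b)\<^sup>2) = 0"
      by (simp add: \<Phi>'_def inner_add_right inner_sum_right power2_eq_square)
    moreover have "(\<Sum>i<n. (h \<bullet> D i x)\<^sup>2) \<ge> 0" "(\<Sum>b\<in>B. (h \<bullet> b)\<^sup>2) \<ge> 0"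
      by (simp_all add: sum_nonneg)
    ultimately have "(\<Sum>i<n. (h \<bullet> D i x)\<^sup>2) = 0" "(\<Sum>b\<in>B. (h \<bullet> b)\<^sup>2) = 0" by linarith+
    then have hD: "\<And>i. i < n \<Longrightarrow> h \<bullet> D i x = 0" and hB: "\<And>b. b \<in> B \<Longrightarrow> h \<bullet> b = 0"
      using \<open>finite B\<close> by (simp_all add: sum_nonneg_eq_0_iff)
    have "orthogonal h y" if "y \<in> ?N" for y
      by (rule orthogonal_to_span[OF that]) (use hD in \<open>auto simp: orthogonal_def\<close>)
    then have "h \<in> span B"
      unfolding B orthogonal_comp_def by (auto simp: orthogonal_commute)
    then have "orthogonal h h"
      by (rule orthogonal_to_span) (simp add: hB orthogonal_def)
    then show "h = 0" by (simp add: orthogonal_self)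
  qed
  obtain g where g: "linear g" "g \<circ> \<Phi>' x = id"
    using linear_injective_left_inverse[OF bounded_linear.linear[OF lin] inj] by blast
  have "Blinfun g o\<^sub>L Blinfun (\<Phi>' x) = id_blinfun"
    using g by (intro blinfun_eqI)
      (simp add: app bounded_linear_Blinfun_apply linear_conv_bounded_linear[symmetric] fun_eq_iff)
  from inverse_function_theorem[OF \<open>open U\<close> der cont \<open>x \<in> U\<close> this]
  obtain W V \<gamma> \<gamma>' where "open W" "W \<subseteq> U" "x \<in> W" "open V"
    and hom: "homeomorphism W V \<Phi> \<gamma>"
    and der\<gamma>: "\<And>p. p \<in> V \<Longrightarrow> (\<gamma> has_derivative \<gamma>' p) (at p)"
    and \<gamma>': "\<And>p. p \<in> V \<Longrightarrow> \<gamma>' p = inv (blinfun_apply (Blinfun (\<Phi>' (\<gamma> p))))"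
    and bij: "\<And>p. p \<in> V \<Longrightarrow> bij (blinfun_apply (Blinfun (\<Phi>' (\<gamma> p))))"
    by metis
  have tangent: "w \<in> tangent_cone X y" if y: "y \<in> X \<inter> W" and w: "\<And>i. i < n \<Longrightarrow> w \<bullet> D i y = 0" for y w
  proof -
    have "y \<in> X \<inter> U" using y \<open>W \<subseteq> U\<close> by blast
    have V: "\<Phi> y \<in> V" and \<gamma>y: "\<gamma> (\<Phi> y) = y"
      using hom y by (auto simp: homeomorphism_def)
    define a where "a = \<Phi>' y w"
    have a: "a = (\<Sum>b\<in>B. (w \<bullet> b) *\<^sub>R b)"
      using w by (simp add: a_def \<Phi>'_def)
    obtain \<rho> where "\<rho> > 0" and \<rho>: "ball (\<Phi> y) \<rho> \<subseteq> V"
      using \<open>open V\<close> V open_contains_ball by blast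
    define r where "r = \<rho> / (norm a + 1)"
    have na: "norm a + 1 > 0" using norm_ge_zero[of a] by linarith
    have "r > 0" using \<open>\<rho> > 0\<close> na by (simp add: r_def)
    have "\<gamma> (\<Phi> y + t *\<^sub>R a) \<in> X" if "0 < t" "t < r" for t
    proof -
      have "t * (norm a + 1) < \<rho>" using that na by (simp add: r_def pos_less_divide_eq)
      then have "norm (t *\<^sub>R a) < \<rho>" using that by (simp add: algebra_simps)
      then have inV: "\<Phi> y + t *\<^sub>R a \<in> V" by (intro subsetD[OF \<rho>]) (simp add: dist_norm)
      define c where "c = \<gamma> (\<Phi> y + t *\<^sub>R a)"
      have "c \<in> W" and \<Phi>c: "\<Phi> c = \<Phi> y + t *\<^sub>R a"
        using hom inV by (auto simp: homeomorphism_def c_def)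
      have \<Phi>y: "\<Phi> y = (\<Sum>b\<in>B. (y \<bullet> b) *\<^sub>R b)"
        using G0[OF \<open>y \<in> X \<inter> U\<close>] by (simp add: \<Phi>_def)
      let ?s = "\<Sum>i<n. G i c *\<^sub>R D i x"
      have "?s = \<Phi> y + t *\<^sub>R a - (\<Sum>b\<in>B. (c \<bullet> b) *\<^sub>R b)"
        using \<Phi>c unfolding \<Phi>_def[of c] by (simp only: eq_diff_eq)
      then have "?s = (\<Sum>b\<in>B. (y \<bullet> b) *\<^sub>R b) + t *\<^sub>R (\<Sum>b\<in>B. (w \<bullet> b) *\<^sub>R b) - (\<Sum>b\<in>B. (c \<bullet> b) *\<^sub>R b)"
        by (simp only: \<Phi>y a)
      moreover have "\<dots> \<in> span B"
        by (intro span_add span_diff span_scale span_sum span_base) auto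
      ultimately have "?s \<in> ?N\<^sup>\<bottom>" using B by simp
      moreover have "?s \<in> ?N"
        by (intro span_sum span_scale span_base) auto
      ultimately have "?s = 0"
        using orthogonal_Int_0[of ?N] by auto
      then have "G i c = 0" if "i < n" for i
        using sum_eq_0_imp_coeff_0[OF rank, of "\<lambda>i. G i c", OF _ that] by blast
      then show ?thesis
        using X \<open>c \<in> W\<close> \<open>W \<subseteq> U\<close> unfolding c_def by blast
    qed
    then have "\<gamma>' (\<Phi> y) a \<in> tangent_cone X (\<gamma> (\<Phi> y))"
      using curve_velocity_in_tangent_cone[OF der\<gamma>[OF V] _ \<open>r > 0\<close>, of X a] y \<gamma>y by simp
    moreover have "\<gamma>' (\<Phi> y) a = w"
      using bij[OF V] unfolding \<gamma>'[OF V] \<gamma>y app a_def by (simp add: bij_is_inj)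
    ultimately show ?thesis using \<gamma>y by simp
  qed
  have tangent_perp: "w \<bullet> D i y = 0" if y: "y \<in> X \<inter> U" and w: "w \<in> tangent_cone X y" and "i < n" for y w i
  proof -
    have "c *\<^sub>R D i y \<in> regular_normal_cone X y" for c
      using y G0 \<open>i < n\<close> by (intro gradient_regular_normal[OF derG \<open>open U\<close>]) auto
    then have "(c *\<^sub>R D i y) \<bullet> w \<le> 0" for c
      using w by (rule regular_normal_inner_tangent_le_0)
    from this[of 1] this[of "- 1"] show ?thesis by (simp add: inner_commute)
  qed
  show thesis
  proof (rule that[of W n D])
    show "continuous_on W (D i)" if "i < n" for i
      using contD[OF that] \<open>W \<subseteq> U\<close> by (rule continuous_on_subset)
    show "(\<Sum>i<n. c i *\<^sub>R D i y) \<in> regular_normal_cone X y" if "y \<in> X \<inter> W" for y c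
      using normals that \<open>W \<subseteq> U\<close> by blast
    show "w \<in> tangent_cone X y \<longleftrightarrow> (\<forall>i<n. w \<bullet> D i y = 0)" if "y \<in> X \<inter> W" for y w
      using tangent tangent_perp that \<open>W \<subseteq> U\<close> by blast
  qed fact+
qed

lemma horizontal_regular_normal:
  fixes F :: "'a::euclidean_space \<Rightarrow> 'b::euclidean_space"
  assumes "n \<in> regular_normal_cone X y"
  shows "(n, 0) \<in> regular_normal_cone (gph (restr (single_valued_map F) X)) (y, F y)"
  unfolding regular_normal_cone_iff
proof (intro conjI allI impI)
  show "(y, F y) \<in> gph (restr (single_valued_map F) X)"
    using assms by (simp add: regular_normal_cone_iff gph_restr_single_valued)
  fix \<epsilon> :: real assume "\<epsilon> > 0"
  then obtain \<delta> where "\<delta> > 0"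
    and \<delta>: "\<And>y'. y' \<in> X \<Longrightarrow> norm (y' - y) < \<delta> \<Longrightarrow> n \<bullet> (y' - y) \<le> \<epsilon> * norm (y' - y)"
    using assms unfolding regular_normal_cone_iff by blast
  have "(n, 0) \<bullet> (p - (y, F y)) \<le> \<epsilon> * norm (p - (y, F y))"
    if "p \<in> gph (restr (single_valued_map F) X)" "norm (p - (y, F y)) < \<delta>" for p
  proof -
    from that(1) obtain y' where p: "p = (y', F y')" and "y' \<in> X"
      by (auto simp: gph_restr_single_valued)
    have le: "norm (y' - y) \<le> norm (p - (y, F y))"
      using norm_fst_le[of "y' - y" "F y' - F y"] by (simp add: p)
    have "(n, 0) \<bullet> (p - (y, F y)) = n \<bullet> (y' - y)" by (simp add: p)
    also have "\<dots> \<le> \<epsilon> * norm (y' - y)" using le that(2) \<open>y' \<in> X\<close> by (intro \<delta>) auto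
    also have "\<dots> \<le> \<epsilon> * norm (p - (y, F y))" using le \<open>\<epsilon> > 0\<close> by simp
    finally show ?thesis .
  qed
  then show "\<exists>\<delta>>0. \<forall>p\<in>gph (restr (single_valued_map F) X). norm (p - (y, F y)) < \<delta> \<longrightarrow>
      (n, 0) \<bullet> (p - (y, F y)) \<le> \<epsilon> * norm (p - (y, F y))"
    using \<open>\<delta> > 0\<close> by blast
qed

text \<open>
  Regular normal cones are convex, and a normal of \<open>X\<close> is a horizontal normal of the graph over \<open>X\<close>. As
  the given combination of gradients depends continuously on the point, this passes to limiting normals.
\<close>
lemma normal_cone_gph_add_horizontal:
  fixes F :: "'a::euclidean_space \<Rightarrow> 'b::euclidean_space" and D :: "nat \<Rightarrow> 'a \<Rightarrow> 'a"
  assumes "open W" and "y \<in> W" and contD: "\<And>i. i < n \<Longrightarrow> continuous_on W (D i)"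
    and normals: "\<And>y c. y \<in> X \<inter> W \<Longrightarrow> (\<Sum>i<n. c i *\<^sub>R D i y) \<in> regular_normal_cone X y"
    and N: "(v, q) \<in> normal_cone (gph (restr (single_valued_map F) X)) (y, F y)"
  shows "(v + (\<Sum>i<n. c i *\<^sub>R D i y), q) \<in> normal_cone (gph (restr (single_valued_map F) X)) (y, F y)"
proof -
  let ?G = "gph (restr (single_valued_map F) X)"
  obtain ps as where mem: "(y, F y) \<in> ?G" and reg: "\<And>k::nat. as k \<in> regular_normal_cone ?G (ps k)"
    and lim: "ps \<longlonglongrightarrow> (y, F y)" "as \<longlonglongrightarrow> (v, q)"
    using N unfolding normal_cone_def by auto
  have "\<forall>k. \<exists>x'. x' \<in> X \<and> ps k = (x', F x')"
    using reg unfolding regular_normal_cone_iff by (force simp: gph_restr_single_valued)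
  then obtain xs where xs: "\<And>k. xs k \<in> X \<and> ps k = (xs k, F (xs k))" by metis
  have "(\<lambda>k. fst (ps k)) \<longlonglongrightarrow> y" using tendsto_fst[OF lim(1)] by simp
  then have "xs \<longlonglongrightarrow> y" using xs by simp
  then have "\<forall>\<^sub>F k in sequentially. xs k \<in> W"
    using \<open>open W\<close> \<open>y \<in> W\<close> by (rule topological_tendstoD)
  then obtain m where m: "\<And>k. k \<ge> m \<Longrightarrow> xs k \<in> W"
    unfolding eventually_sequentially by blast
  define zs where "zs k = xs (k + m)" for k
  have z: "zs \<longlonglongrightarrow> y" unfolding zs_def using \<open>xs \<longlonglongrightarrow> y\<close> by (rule LIMSEQ_ignore_initial_segment)
  have zW: "zs k \<in> X \<inter> W" for k using xs m[of "k + m"] by (simp add: zs_def)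
  have "(\<lambda>k. D i (zs k)) \<longlonglongrightarrow> D i y" if "i < n" for i
    using zW \<open>y \<in> W\<close> by (intro continuous_on_tendsto_compose[OF contD[OF that] z]) auto
  then have sum: "(\<lambda>k. \<Sum>i<n. c i *\<^sub>R D i (zs k)) \<longlonglongrightarrow> (\<Sum>i<n. c i *\<^sub>R D i y)"
    by (intro tendsto_sum tendsto_scaleR tendsto_const) auto
  have "as (k + m) + (\<Sum>i<n. c i *\<^sub>R D i (zs k), 0) \<in> normal_cone ?G (ps (k + m))" for k
  proof -
    have "(\<Sum>i<n. c i *\<^sub>R D i (zs k), 0) \<in> regular_normal_cone ?G (ps (k + m))"
      using horizontal_regular_normal[OF normals[OF zW[of k]]] xs[of "k + m"] by (simp add: zs_def)
    then show ?thesis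
      using regular_normal_cone_add[OF reg[of "k + m"]] regular_normal_cone_subset_normal_cone by blast
  qed
  then have "(v, q) + (\<Sum>i<n. c i *\<^sub>R D i y, 0) \<in> normal_cone ?G (y, F y)"
    by (rule normal_cone_limit[OF mem LIMSEQ_ignore_initial_segment[OF lim(1)]
          tendsto_add[OF LIMSEQ_ignore_initial_segment[OF lim(2)] tendsto_Pair[OF sum tendsto_const]]])
  then show ?thesis by simp
qed

text \<open>
  On a manifold the projections in the definition of the projectional coderivative can be absorbed. Projecting
  \<open>v\<close> on the tangent space subtracts a normal of \<open>X\<close>, so that the projected vector still belongs to a normal
  of the graph of \<open>F\<close> on \<open>X\<close>, and both this and tangency persist in the limit.
\<close>
lemma proj_coderivative_manifold:
  fixes F :: "'a::euclidean_space \<Rightarrow> 'b::euclidean_space"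
  assumes mfd: "smooth_manifold_around d X x"
    and t': "t' \<in> proj_coderivative X (single_valued_map F) x (F x) z"
  shows "t' \<in> tangent_cone X x"
    and "(t', - z) \<in> normal_cone (gph (restr (single_valued_map F) X)) (x, F x)"
proof -
  let ?G = "gph (restr (single_valued_map F) X)"
  obtain W n and D :: "nat \<Rightarrow> 'a \<Rightarrow> 'a" where "open W" "x \<in> W"
    and contD: "\<And>i. i < n \<Longrightarrow> continuous_on W (D i)"
    and normals: "\<And>y c. y \<in> X \<inter> W \<Longrightarrow> (\<Sum>i<n. c i *\<^sub>R D i y) \<in> regular_normal_cone X y"
    and tangents: "\<And>y w. y \<in> X \<inter> W \<Longrightarrow> w \<in> tangent_cone X y \<longleftrightarrow> (\<forall>i<n. w \<bullet> D i y = 0)"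
    using that by (rule smooth_manifold_cones[OF mfd])
  have "x \<in> X" using mfd by (simp add: smooth_manifold_around_def)
  obtain ys' ws' vs' ts' zs'
    where N': "\<And>k::nat. (vs' k, - zs' k) \<in> normal_cone ?G (ys' k, ws' k)"
      and proj': "\<And>k. ts' k \<in> proj_set (tangent_cone X (ys' k)) (vs' k)"
      and lim': "ys' \<longlonglongrightarrow> x" "ws' \<longlonglongrightarrow> F x" "ts' \<longlonglongrightarrow> t'" "zs' \<longlonglongrightarrow> z"
    using t' unfolding proj_coderivative_iff by blast
  have "\<forall>\<^sub>F k in sequentially. ys' k \<in> W"
    using lim'(1) \<open>open W\<close> \<open>x \<in> W\<close> by (rule topological_tendstoD)
  then obtain m where m: "\<And>k. k \<ge> m \<Longrightarrow> ys' k \<in> W"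
    unfolding eventually_sequentially by blast
  define ys ws vs ts zs where "ys k = ys' (k + m)" and "ws k = ws' (k + m)" and "vs k = vs' (k + m)"
    and "ts k = ts' (k + m)" and "zs k = zs' (k + m)" for k
  note defs = ys_def ws_def vs_def ts_def zs_def
  have N: "(vs k, - zs k) \<in> normal_cone ?G (ys k, ws k)"
    and proj: "ts k \<in> proj_set (tangent_cone X (ys k)) (vs k)" and "ys k \<in> W" for k
    using N'[of "k + m"] proj'[of "k + m"] m[of "k + m"] by (simp_all add: defs)
  have y: "ys \<longlonglongrightarrow> x" and w: "ws \<longlonglongrightarrow> F x" and t: "ts \<longlonglongrightarrow> t'" and z: "zs \<longlonglongrightarrow> z"
    unfolding defs using lim' by (simp_all add: LIMSEQ_ignore_initial_segment)
  have yX: "ys k \<in> X \<inter> W" and wF: "ws k = F (ys k)" for k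
    using N[of k] \<open>ys k \<in> W\<close> by (auto simp: normal_cone_def gph_restr_single_valued)
  have Nt: "(ts k, - zs k) \<in> normal_cone ?G (ys k, ws k)" for k
  proof -
    let ?S = "(\<lambda>i. D i (ys k)) ` {..<n}"
    obtain a b where a: "a \<in> span ?S" and b: "\<And>c. c \<in> span ?S \<Longrightarrow> orthogonal b c"
      and ab: "vs k = a + b"
      using orthogonal_subspace_decomp_exists[of ?S "vs k"] by blast
    have "b \<bullet> D i (ys k) = 0" if "i < n" for i
      using b[of "D i (ys k)"] that by (simp add: orthogonal_def span_base)
    then have bT: "b \<in> tangent_cone X (ys k)" using tangents[OF yX] by blast
    have tT: "ts k \<in> tangent_cone X (ys k)" using proj by (simp add: proj_set_iff)
    then have "b - ts k \<in> tangent_cone X (ys k)"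
      using bT unfolding tangents[OF yX] by (simp add: inner_diff_left)
    then have "orthogonal (b - ts k) c" if "c \<in> ?S" for c
      using that unfolding tangents[OF yX] by (auto simp: orthogonal_def)
    then have orth: "orthogonal (b - ts k) a"
      by (rule orthogonal_to_span[OF a])
    \<comment> \<open>By Pythagoras, the tangential part \<open>b\<close> is the only nearest point.\<close>
    have "norm (ts k - vs k) \<le> norm (b - vs k)"
      using proj bT by (simp add: proj_set_iff)
    then have "norm (a + (b - ts k)) \<le> norm a"
      by (simp add: ab norm_minus_commute[of "ts k"] add_diff_eq)
    then have "(norm (a + (b - ts k)))\<^sup>2 \<le> (norm a)\<^sup>2"
      by (intro power_mono) auto
    moreover have "(norm (a + (b - ts k)))\<^sup>2 = (norm a)\<^sup>2 + (norm (b - ts k))\<^sup>2"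
      using orth by (intro norm_add_Pythagorean) (simp add: orthogonal_commute)
    ultimately have "b = ts k" by simp
    moreover obtain c where "a = (\<Sum>i<n. c i *\<^sub>R D i (ys k))"
      using a span_image_finite[of "{..<n}" "\<lambda>i. D i (ys k)"] by auto
    ultimately have tk: "ts k = vs k + (\<Sum>i<n. (- c i) *\<^sub>R D i (ys k))"
      using ab by (simp add: sum_negf)
    have "(vs k, - zs k) \<in> normal_cone ?G (ys k, F (ys k))"
      using N[of k] wF[of k] by simp
    from normal_cone_gph_add_horizontal[OF \<open>open W\<close> \<open>ys k \<in> W\<close> contD normals this, where c = "\<lambda>i. - c i"]
    show ?thesis by (simp only: tk wF)
  qed
  have "(x, F x) \<in> ?G" using \<open>x \<in> X\<close> by (simp add: gph_restr_single_valued)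
  then show "(t', - z) \<in> normal_cone ?G (x, F x)"
    using Nt by (rule normal_cone_limit[OF _ tendsto_Pair[OF y w] tendsto_Pair[OF t tendsto_minus[OF z]]])
  have "t' \<bullet> D i x = 0" if "i < n" for i
  proof -
    have "(\<lambda>k. D i (ys k)) \<longlonglongrightarrow> D i x"
      using yX \<open>x \<in> W\<close> by (intro continuous_on_tendsto_compose[OF contD[OF that] y]) auto
    then have "(\<lambda>k. ts k \<bullet> D i (ys k)) \<longlonglongrightarrow> t' \<bullet> D i x"
      by (intro tendsto_inner t)
    moreover have "ts k \<bullet> D i (ys k) = 0" for k
      using proj[of k] tangents[OF yX[of k]] that by (simp add: proj_set_iff)
    ultimately show ?thesis by (simp add: LIMSEQ_const_iff)
  qed
  then show "t' \<in> tangent_cone X x"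
    using tangents[of x t'] \<open>x \<in> X\<close> \<open>x \<in> W\<close> by blast
qed

section \<open>The chain rule for the projectional coderivative\<close>

theorem theorem5p4:
  fixes X :: "(real ^ 'n) set"
    and S\<^sub>0 :: "(real ^ 'p, real ^ 'm) setmap"
    and F :: "real ^ 'n \<Rightarrow> real ^ 'p"
    and S :: "(real ^ 'n, real ^ 'm) setmap"
    and x :: "real ^ 'n" and u :: "real ^ 'm"
  assumes "closed X"
    and "outer_semicontinuous S\<^sub>0"
    and "S = comp_map S\<^sub>0 (single_valued_map F)"
    and "u \<in> restr S X x"
    and "coderivative S\<^sub>0 (F x) u 0 \<inter>
         inv_map (proj_coderivative X (single_valued_map F) x (F x)) 0 = {0}"
  shows "(continuous_rel_around X F x \<longrightarrow>
           (\<forall>u'. proj_coderivative X S x u u' \<subseteq>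
             comp_map (proj_coderivative X (single_valued_map F) x (F x))
                      (coderivative S\<^sub>0 (F x) u) u'))
       \<and> (strictly_continuous_rel X F x \<and>
          graphically_regular S\<^sub>0 (F x) u \<and>
          (\<forall>z \<in> rg (coderivative S\<^sub>0 (F x) u). regular_function (scalarization z F X) x) \<and>
          (\<exists>d. smooth_manifold_around d X x) \<longrightarrow>
            graphically_regular (restr S X) x u \<and>
            (\<forall>u'. proj_coderivative X S x u u' =
              comp_map (proj_coderivative X (single_valued_map F) x (F x))
                       (coderivative S\<^sub>0 (F x) u) u'))"
proof -
  let ?D = "proj_coderivative X (single_valued_map F) x (F x)"
  let ?C = "coderivative S\<^sub>0 (F x) u"
  let ?G = "gph (restr (single_valued_map F) X)"
  have clS: "closed (gph S\<^sub>0)" using assms(2) by (rule closed_gph_if_osc)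
  have "(x, u) \<in> gph (restr S X)" using assms(4) by (simp add: mem_gph_iff)
  then have xX: "x \<in> X" and uS: "u \<in> S\<^sub>0 (F x)"
    by (auto simp: assms(3) gph_restr_comp_single_valued)
  have qualification: "z = 0"
    if "(z, 0) \<in> normal_cone (gph S\<^sub>0) (F x, u)" "0 \<in> ?D z" for z
  proof -
    have "z \<in> ?C 0 \<inter> inv_map ?D 0"
      using that by (simp add: coderivative_def inv_map_def)
    then show ?thesis using assms(5) by blast
  qed
  have inclusion: "proj_coderivative X S x u u' \<subseteq> comp_map ?D ?C u'"
    if cont: "continuous_rel_around X F x" for u'
  proof
    fix t' assume t': "t' \<in> proj_coderivative X S x u u'"
    obtain V where V: "open V" "x \<in> V" "continuous_on (X \<inter> V) F"
      using cont unfolding continuous_rel_around_def by blast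
    obtain z where "(z, - u') \<in> normal_cone (gph S\<^sub>0) (F x, u)" "t' \<in> ?D z"
      by (rule proj_coderivative_chain_rule[OF assms(1) clS V(1,2) xX uS V(3) qualification
            t'[unfolded assms(3)]])
    then show "t' \<in> comp_map ?D ?C u'"
      by (auto simp: comp_map_def coderivative_def)
  qed
  moreover have "graphically_regular (restr S X) x u \<and>
      (\<forall>u'. proj_coderivative X S x u u' = comp_map ?D ?C u')"
    if strict: "strictly_continuous_rel X F x" and regS: "graphically_regular S\<^sub>0 (F x) u"
      and regF: "\<forall>z \<in> rg ?C. regular_function (scalarization z F X) x"
      and manifold: "\<exists>d. smooth_manifold_around d X x"
  proof -
    obtain V L where V: "open V" "x \<in> V" and lip: "L-lipschitz_on (X \<inter> V) F"
      using strict unfolding strictly_continuous_rel_def by blast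
    then have cont: "continuous_on (X \<inter> V) F" by (intro lipschitz_on_continuous_on)
    obtain d where mfd: "smooth_manifold_around d X x" using manifold by blast
    have rule: "(v, q) \<in> regular_normal_cone (gph (restr S X)) (x, u)"
      if z1: "(z, q) \<in> normal_cone (gph S\<^sub>0) (F x, u)" and z2: "(v, - z) \<in> normal_cone ?G (x, F x)" for v q z
    proof -
      have "z \<in> ?C (- q)" using z1 by (simp add: coderivative_def)
      then have "regular_function (scalarization z F X) x"
        using regF unfolding rg_def by blast
      from regular_chain_rule[OF assms(1) V lip uS regS this z1 z2] show ?thesis
        by (simp only: assms(3))
    qed
    have "graphically_regular (restr S X) x u"
      unfolding graphically_regular_def clarke_regular_def
    proof (intro conjI equalityI subsetI)
      show "(x, u) \<in> gph (restr S X)" by fact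
      show "locally_closed_at (gph (restr S X)) (x, u)"
        unfolding assms(3) using assms(1) clS V cont by (rule locally_closed_gph_comp)
      show "a \<in> normal_cone (gph (restr S X)) (x, u)"
        if "a \<in> regular_normal_cone (gph (restr S X)) (x, u)" for a
        using that regular_normal_cone_subset_normal_cone by blast
      fix a assume a: "a \<in> normal_cone (gph (restr S X)) (x, u)"
      obtain v q where aq: "a = (v, q)" by (cases a) auto
      have "z = 0" if "(z, 0) \<in> normal_cone (gph S\<^sub>0) (F x, u)" "(0, - z) \<in> normal_cone ?G (x, F x)" for z
      proof (rule qualification[OF that(1)])
        show "0 \<in> ?D z"
          unfolding proj_coderivative_iff
        proof (intro exI conjI allI)
          show "(0, - z) \<in> normal_cone ?G (x, F x)" by (rule that(2))
          show "0 \<in> proj_set (tangent_cone X x) 0"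
            using xX by (simp add: proj_set_iff zero_in_tangent_cone)
        qed (rule tendsto_const)+
      qed
      from normal_cone_chain_rule[OF assms(1) clS V cont this a[unfolded aq assms(3)]]
      show "a \<in> regular_normal_cone (gph (restr S X)) (x, u)"
        using rule aq by blast
    qed
    moreover have "comp_map ?D ?C u' \<subseteq> proj_coderivative X S x u u'" for u'
    proof
      fix t' assume "t' \<in> comp_map ?D ?C u'"
      then obtain z where z: "(z, - u') \<in> normal_cone (gph S\<^sub>0) (F x, u)" and t': "t' \<in> ?D z"
        by (auto simp: comp_map_def coderivative_def)
      have tangent: "t' \<in> tangent_cone X x" and "(t', - z) \<in> normal_cone ?G (x, F x)"
        using proj_coderivative_manifold[OF mfd t'] by auto
      then have N: "(t', - u') \<in> normal_cone (gph (restr S X)) (x, u)"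
        using rule[OF z] regular_normal_cone_subset_normal_cone by blast
      show "t' \<in> proj_coderivative X S x u u'"
        unfolding proj_coderivative_iff
      proof (intro exI conjI allI)
        show "(t', - u') \<in> normal_cone (gph (restr S X)) (x, u)" by (rule N)
        show "t' \<in> proj_set (tangent_cone X x) t'"
          using tangent by (simp add: proj_set_iff)
      qed (rule tendsto_const)+
    qed
    moreover have "continuous_rel_around X F x"
      using V cont unfolding continuous_rel_around_def by blast
    ultimately show ?thesis
      using inclusion by blast
  qed
  ultimately show ?thesis by blast
qed

end
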